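(* Suppose that a locally finite regular building $\mathscr{X}$ of type $W$ exists with parameters $\{q_s\}_{s\in S}$, and let $\mathscr{B}$ be its algebra of chamber set averaging operators. Then $\mathscr{B}\cong\mathscr{H}(q_s^{-1},1-q_s^{-1})$ as algebras over $\mathbb{C}$.
   Context: Let $I$ be a finite set and $(m_{i,j})_{i,j\in I}$ a Coxeter matrix ($m_{i,i}=1$, and $m_{i,j}=m_{j,i}\in\{2,3,\ldots\}\cup\{\infty\}$ for $i\neq j$), with Coxeter group $W=\langle s_i\ (i\in I)\mid (s_is_j)^{m_{i,j}}=1\rangle$ (relation omitted when $m_{i,j}=\infty$), $S=\{s_i\mid i\in I\}$, and length function $\ell$. For a word $f=i_1\cdots i_n$ in $I$ write $s_f=s_{i_1}\cdots s_{i_n}$; $f$ is reduced if $\ell(s_f)=n$. A chamber system over $I$ is a set $\mathcal{C}$ (of chambers) with an equivalence relation $\sim_i$ for each $i\in I$. A gallery of type $i_1\cdots i_n$ is a sequence $c_0,\ldots,c_n$ of chambers with $c_{k-1}\sim_{i_k}c_k$ and $c_{k-1}\neq c_k$ for $1\le k\le n$. A building of type $W$ is a chamber system over $I$ such that (1) for each $c\in\mathcal{C}$ and $i\in I$ there is $d\neq c$ with $d\sim_i c$, and (2) there is a function $\delta:\mathcal{C}\times\mathcal{C}\to W$ such that, for every reduced word $f$, $\delta(c,d)=s_f$ if and only if $c$ and $d$ can be joined by a gallery of type $f$. It is locally finite if $I$ is finite and $\{b\mid a\sim_i b\}$ is finite for all $a\in\mathcal{C}$, $i\in I$. For $a\in\mathcal{C}$,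 $w\in W$ put $\mathcal{C}_w(a)=\{b\in\mathcal{C}\mid\delta(a,b)=w\}$. The building is regular if for each $s\in S$ the number $|\mathcal{C}_s(a)|$ does not depend on $a\in\mathcal{C}$; this number is then written $q_s$, with $q_i=q_{s_i}$, and $\{q_s\}_{s\in S}$ is the parameter system. For $w=s_{i_1}\cdots s_{i_n}$ reduced, put $q_w=q_{i_1}\cdots q_{i_n}$; this is independent of the reduced expression, and $|\mathcal{C}_w(a)|=q_w$ for all $a\in\mathcal{C}$. For $w\in W$ the operator $B_w$ on the space of all functions $f:\mathcal{C}\to\mathbb{C}$ is $(B_wf)(c)=\frac{1}{q_w}\sum_{d\in\mathcal{C}_w(c)}f(d)$. $\mathscr{B}$ is the linear span of $\{B_w\mid w\in W\}$ over $\mathbb{C}$, which is an associative algebra under composition. Given complex numbers $a_s,b_s$ ($s\in S$) with $a_{s'}=a_s$ and $b_{s'}=b_s$ whenever $s'=wsw^{-1}$ for some $w\in W$ (a condition satisfied by $a_s=q_s^{-1}$, $b_s=1-q_s^{-1}$), the (generic) Hecke algebra $\mathscr{H}(a_s,b_s)$ is the associative algebra over $\mathbb{C}$ with vector space basis $\{T_w\mid w\in W\}$ and relations, for $w\in W$, $s\in S$: $T_wT_s=T_{ws}$ when $\ell(ws)=\ell(w)+1$, and $T_wT_s=a_sT_{ws}+b_sT_w$ when $\ell(ws)=\ell(w)-1$. *)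

theory Defs
  imports
    "HOL-Algebra.Module"
    "HOL-Algebra.QuotRing"
    "HOL-Library.Extended_Nat"
    "HOL-Library.Function_Algebras"
    "HOL.Complex"
begin

section \<open>Coxeter groups\<close>

definition coxeter_matrix :: "'i set \<Rightarrow> ('i \<Rightarrow> 'i \<Rightarrow> enat) \<Rightarrow> bool" where
  "coxeter_matrix I m \<longleftrightarrow> finite I \<and> (\<forall>i\<in>I. m i i = 1) \<and>
     (\<forall>i\<in>I. \<forall>j\<in>I. i \<noteq> j \<longrightarrow> m i j = m j i \<and> 2 \<le> m i j)"

text \<open>A group given by generators \<open>X\<close> and relators \<open>R\<close>: signed words, where \<open>(x, True)\<close> stands
  for \<open>x\<close> and \<open>(x, False)\<close> for its formal inverse, modulo the congruence generated by free
  cancellation and by the relators.\<close>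

type_synonym 'i sword = "('i \<times> bool) list"

abbreviation swords :: "'i set \<Rightarrow> 'i sword set" where
  "swords X \<equiv> lists (X \<times> UNIV)"

inductive_set presentation_rel :: "'i set \<Rightarrow> 'i sword set \<Rightarrow> ('i sword \<times> 'i sword) set"
  for X :: "'i set" and R :: "'i sword set" where
  refl: "u \<in> swords X \<Longrightarrow> (u, u) \<in> presentation_rel X R"
| sym: "(u, v) \<in> presentation_rel X R \<Longrightarrow> (v, u) \<in> presentation_rel X R"
| trans: "(u, v) \<in> presentation_rel X R \<Longrightarrow> (v, w) \<in> presentation_rel X R \<Longrightarrow>
    (u, w) \<in> presentation_rel X R"
| cancel: "u \<in> swords X \<Longrightarrow> v \<in> swords X \<Longrightarrow> x \<in> X \<Longrightarrow>
    (u @ [(x, b), (x, \<not> b)] @ v, u @ v) \<in> presentation_rel X R"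
| relator: "u \<in> swords X \<Longrightarrow> v \<in> swords X \<Longrightarrow> r \<in> R \<Longrightarrow> r \<in> swords X \<Longrightarrow>
    (u @ r @ v, u @ v) \<in> presentation_rel X R"

definition presented_group :: "'i set \<Rightarrow> 'i sword set \<Rightarrow> 'i sword set monoid" where
  "presented_group X R =
     \<lparr>carrier = swords X // presentation_rel X R,
      monoid.mult = (\<lambda>A B. \<Union>u\<in>A. \<Union>v\<in>B. presentation_rel X R `` {u @ v}),
      one = presentation_rel X R `` {[]}\<rparr>"

definition coxeter_relators :: "'i set \<Rightarrow> ('i \<Rightarrow> 'i \<Rightarrow> enat) \<Rightarrow> 'i sword set" where
  "coxeter_relators I m =
     {concat (replicate k [(i, True), (j, True)]) | i j k. i \<in> I \<and> j \<in> I \<and> m i j = enat k}"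

definition coxeter_group :: "'i set \<Rightarrow> ('i \<Rightarrow> 'i \<Rightarrow> enat) \<Rightarrow> 'i sword set monoid" where
  "coxeter_group I m = presented_group I (coxeter_relators I m)"

definition coxeter_gen :: "'i set \<Rightarrow> ('i \<Rightarrow> 'i \<Rightarrow> enat) \<Rightarrow> 'i \<Rightarrow> 'i sword set" where
  "coxeter_gen I m i = presentation_rel I (coxeter_relators I m) `` {[(i, True)]}"

definition word_elt :: "'i set \<Rightarrow> ('i \<Rightarrow> 'i \<Rightarrow> enat) \<Rightarrow> 'i list \<Rightarrow> 'i sword set" where
  "word_elt I m f =
     foldr (\<otimes>\<^bsub>coxeter_group I m\<^esub>) (map (coxeter_gen I m) f) \<one>\<^bsub>coxeter_group I m\<^esub>"

definition coxeter_length :: "'i set \<Rightarrow> ('i \<Rightarrow> 'i \<Rightarrow> enat) \<Rightarrow> 'i sword set \<Rightarrow> nat" where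
  "coxeter_length I m w = (LEAST n. \<exists>f\<in>lists I. length f = n \<and> word_elt I m f = w)"

definition reduced :: "'i set \<Rightarrow> ('i \<Rightarrow> 'i \<Rightarrow> enat) \<Rightarrow> 'i list \<Rightarrow> bool" where
  "reduced I m f \<longleftrightarrow> f \<in> lists I \<and> coxeter_length I m (word_elt I m f) = length f"


section \<open>Buildings\<close>

text \<open>The chambers form a whole type \<open>'c\<close>; in particular a chamber system is nonempty here.\<close>

definition chamber_system :: "'i set \<Rightarrow> ('i \<Rightarrow> ('c \<times> 'c) set) \<Rightarrow> bool" where
  "chamber_system I adj \<longleftrightarrow> (\<forall>i\<in>I. equiv UNIV (adj i))"

definition gallery :: "('i \<Rightarrow> ('c \<times> 'c) set) \<Rightarrow> 'i list \<Rightarrow> 'c list \<Rightarrow> bool" where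
  "gallery adj f cs \<longleftrightarrow> length cs = Suc (length f) \<and>
     (\<forall>k<length f. (cs ! k, cs ! Suc k) \<in> adj (f ! k) \<and> cs ! k \<noteq> cs ! Suc k)"

definition joined :: "('i \<Rightarrow> ('c \<times> 'c) set) \<Rightarrow> 'i list \<Rightarrow> 'c \<Rightarrow> 'c \<Rightarrow> bool" where
  "joined adj f c d \<longleftrightarrow> (\<exists>cs. gallery adj f cs \<and> hd cs = c \<and> last cs = d)"

text \<open>The function \<open>\<delta>\<close> is uniquely determined by the chamber system, as every element of the
  Coxeter group has a reduced word.\<close>

definition building ::
  "'i set \<Rightarrow> ('i \<Rightarrow> 'i \<Rightarrow> enat) \<Rightarrow> ('i \<Rightarrow> ('c \<times> 'c) set) \<Rightarrow> ('c \<Rightarrow> 'c \<Rightarrow> 'i sword set) \<Rightarrow> bool" where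
  "building I m adj \<delta> \<longleftrightarrow>
     coxeter_matrix I m \<and> chamber_system I adj \<and>
     (\<forall>c. \<forall>i\<in>I. \<exists>d. d \<noteq> c \<and> (d, c) \<in> adj i) \<and>
     (\<forall>c d. \<delta> c d \<in> carrier (coxeter_group I m)) \<and>
     (\<forall>f. reduced I m f \<longrightarrow> (\<forall>c d. \<delta> c d = word_elt I m f \<longleftrightarrow> joined adj f c d))"

definition locally_finite :: "'i set \<Rightarrow> ('i \<Rightarrow> ('c \<times> 'c) set) \<Rightarrow> bool" where
  "locally_finite I adj \<longleftrightarrow> finite I \<and> (\<forall>a. \<forall>i\<in>I. finite {b. (a, b) \<in> adj i})"

definition chamber_sphere :: "('c \<Rightarrow> 'c \<Rightarrow> 'w) \<Rightarrow> 'w \<Rightarrow> 'c \<Rightarrow> 'c set" where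
  "chamber_sphere \<delta> w a = {b. \<delta> a b = w}"

text \<open>Only the values \<open>q s\<close> at the generators \<open>s \<in> S\<close> matter.\<close>

definition regular_with_parameters ::
  "'i set \<Rightarrow> ('i \<Rightarrow> 'i \<Rightarrow> enat) \<Rightarrow> ('c \<Rightarrow> 'c \<Rightarrow> 'i sword set) \<Rightarrow> ('i sword set \<Rightarrow> nat) \<Rightarrow> bool" where
  "regular_with_parameters I m \<delta> q \<longleftrightarrow>
     (\<forall>s\<in>coxeter_gen I m ` I. \<forall>a. card (chamber_sphere \<delta> s a) = q s)"

text \<open>For the parameters of a locally finite regular building, \<open>q\<^sub>w\<close> does not depend on the
  reduced word chosen.\<close>

definition param ::
  "'i set \<Rightarrow> ('i \<Rightarrow> 'i \<Rightarrow> enat) \<Rightarrow> ('i sword set \<Rightarrow> nat) \<Rightarrow> 'i sword set \<Rightarrow> nat" where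
  "param I m q w =
     prod_list (map (q \<circ> coxeter_gen I m) (SOME f. reduced I m f \<and> word_elt I m f = w))"


section \<open>Complex algebras\<close>

definition complex_field :: "complex ring" where
  "complex_field = \<lparr>carrier = UNIV, monoid.mult = (*), one = 1, ring.zero = 0, add = (+)\<rparr>"

text \<open>The library locale \<^locale>\<open>algebra\<close> is restricted to commutative algebras.\<close>

definition complex_algebra :: "(complex, 'a) module \<Rightarrow> bool" where
  "complex_algebra A \<longleftrightarrow> ring A \<and> Module.module complex_field A \<and>
     (\<forall>k. \<forall>x\<in>carrier A. \<forall>y\<in>carrier A.
        (k \<odot>\<^bsub>A\<^esub> x) \<otimes>\<^bsub>A\<^esub> y = k \<odot>\<^bsub>A\<^esub> (x \<otimes>\<^bsub>A\<^esub> y) \<and>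
        x \<otimes>\<^bsub>A\<^esub> (k \<odot>\<^bsub>A\<^esub> y) = k \<odot>\<^bsub>A\<^esub> (x \<otimes>\<^bsub>A\<^esub> y))"

definition algebras_isomorphic :: "(complex, 'a) module \<Rightarrow> (complex, 'b) module \<Rightarrow> bool" where
  "algebras_isomorphic A B \<longleftrightarrow> complex_algebra A \<and> complex_algebra B \<and>
     (\<exists>\<phi>\<in>ring_iso A B. \<forall>k. \<forall>x\<in>carrier A. \<phi> (k \<odot>\<^bsub>A\<^esub> x) = k \<odot>\<^bsub>B\<^esub> \<phi> x)"


section \<open>The algebra of chamber set averaging operators\<close>

type_synonym 'c operator = "('c \<Rightarrow> complex) \<Rightarrow> ('c \<Rightarrow> complex)"

definition averaging_op ::
  "'i set \<Rightarrow> ('i \<Rightarrow> 'i \<Rightarrow> enat) \<Rightarrow> ('c \<Rightarrow> 'c \<Rightarrow> 'i sword set) \<Rightarrow> ('i sword set \<Rightarrow> nat) \<Rightarrow>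
    'i sword set \<Rightarrow> 'c operator" where
  "averaging_op I m \<delta> q w f c =
     (1 / of_nat (param I m q w)) * (\<Sum>d\<in>chamber_sphere \<delta> w c. f d)"

definition scale_op :: "complex \<Rightarrow> 'c operator \<Rightarrow> 'c operator" where
  "scale_op k F = (\<lambda>f c. k * F f c)"

definition averaging_algebra ::
  "'i set \<Rightarrow> ('i \<Rightarrow> 'i \<Rightarrow> enat) \<Rightarrow> ('c \<Rightarrow> 'c \<Rightarrow> 'i sword set) \<Rightarrow> ('i sword set \<Rightarrow> nat) \<Rightarrow>
    (complex, 'c operator) module" where
  "averaging_algebra I m \<delta> q =
     \<lparr>carrier = Modules.module.span scale_op
                  (averaging_op I m \<delta> q ` carrier (coxeter_group I m)),
      monoid.mult = (\<circ>), one = id, ring.zero = 0, add = (+), smult = scale_op\<rparr>"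


section \<open>Generic Hecke algebras\<close>

definition hecke_parameters ::
  "'i set \<Rightarrow> ('i \<Rightarrow> 'i \<Rightarrow> enat) \<Rightarrow> ('i sword set \<Rightarrow> complex) \<Rightarrow> ('i sword set \<Rightarrow> complex) \<Rightarrow> bool" where
  "hecke_parameters I m a b \<longleftrightarrow>
     (\<forall>s\<in>coxeter_gen I m ` I. \<forall>s'\<in>coxeter_gen I m ` I. \<forall>w\<in>carrier (coxeter_group I m).
        s' = w \<otimes>\<^bsub>coxeter_group I m\<^esub> s \<otimes>\<^bsub>coxeter_group I m\<^esub> inv\<^bsub>coxeter_group I m\<^esub> w \<longrightarrow>
        a s' = a s \<and> b s' = b s)"

text \<open>The vector space with basis \<open>T\<^sub>w\<close> is realised by the finitely supported functions on \<open>W\<close>,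
  with \<open>T\<^sub>w\<close> the indicator function of \<open>w\<close>. The identity of the algebra is \<open>T\<^sub>1\<close>.\<close>

definition hecke_T :: "'w \<Rightarrow> 'w \<Rightarrow> complex" where
  "hecke_T w = (\<lambda>v. if v = w then 1 else 0)"

definition hecke_structure ::
  "'i set \<Rightarrow> ('i \<Rightarrow> 'i \<Rightarrow> enat) \<Rightarrow>
    (('i sword set \<Rightarrow> complex) \<Rightarrow> ('i sword set \<Rightarrow> complex) \<Rightarrow> ('i sword set \<Rightarrow> complex)) \<Rightarrow>
    (complex, 'i sword set \<Rightarrow> complex) module" where
  "hecke_structure I m M =
     \<lparr>carrier = {x. finite {w. x w \<noteq> 0} \<and> {w. x w \<noteq> 0} \<subseteq> carrier (coxeter_group I m)},
      monoid.mult = M, one = hecke_T \<one>\<^bsub>coxeter_group I m\<^esub>,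
      ring.zero = 0, add = (+), smult = (\<lambda>k x w. k * x w)\<rparr>"

definition is_hecke_product ::
  "'i set \<Rightarrow> ('i \<Rightarrow> 'i \<Rightarrow> enat) \<Rightarrow> ('i sword set \<Rightarrow> complex) \<Rightarrow> ('i sword set \<Rightarrow> complex) \<Rightarrow>
    (('i sword set \<Rightarrow> complex) \<Rightarrow> ('i sword set \<Rightarrow> complex) \<Rightarrow> ('i sword set \<Rightarrow> complex)) \<Rightarrow> bool" where
  "is_hecke_product I m a b M \<longleftrightarrow>
     hecke_parameters I m a b \<and> complex_algebra (hecke_structure I m M) \<and>
     (\<forall>w\<in>carrier (coxeter_group I m). \<forall>s\<in>coxeter_gen I m ` I.
        (let ws = w \<otimes>\<^bsub>coxeter_group I m\<^esub> s; H = hecke_structure I m M; T = hecke_T in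
          (coxeter_length I m ws = coxeter_length I m w + 1 \<longrightarrow>
             T w \<otimes>\<^bsub>H\<^esub> T s = T ws) \<and>
          (int (coxeter_length I m ws) = int (coxeter_length I m w) - 1 \<longrightarrow>
             T w \<otimes>\<^bsub>H\<^esub> T s = a s \<odot>\<^bsub>H\<^esub> T ws \<oplus>\<^bsub>H\<^esub> b s \<odot>\<^bsub>H\<^esub> T w)))"

text \<open>The product is determined on the carrier by these conditions (lemma
  \<open>hecke_product_unique\<close> below); its values elsewhere are irrelevant, hence the use of choice.\<close>

definition hecke_algebra ::
  "'i set \<Rightarrow> ('i \<Rightarrow> 'i \<Rightarrow> enat) \<Rightarrow> ('i sword set \<Rightarrow> complex) \<Rightarrow> ('i sword set \<Rightarrow> complex) \<Rightarrow>
    (complex, 'i sword set \<Rightarrow> complex) module" where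
  "hecke_algebra I m a b = hecke_structure I m (SOME M. is_hecke_product I m a b M)"


section \<open>Well-definedness\<close>

lemma presentation_rel_swords:
  assumes "(u, v) \<in> presentation_rel X R"
  shows "u \<in> swords X \<and> v \<in> swords X"
  using assms by (induction rule: presentation_rel.induct) auto

lemma equiv_presentation_rel: "equiv (swords X) (presentation_rel X R)"
proof (rule equivI)
  show "presentation_rel X R \<subseteq> swords X \<times> swords X"
    using presentation_rel_swords by fastforce
  show "refl_on (swords X) (presentation_rel X R)"
    by (auto intro!: refl_onI presentation_rel.refl)
  show "Relation.sym (presentation_rel X R)"
    by (auto intro!: symI presentation_rel.sym)
  show "Relation.trans (presentation_rel X R)"
    by (auto intro!: transI intro: presentation_rel.trans)
qed

lemma presentation_rel_context:
  assumes "(u, v) \<in> presentation_rel X R" "a \<in> swords X" "b \<in> swords X"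
  shows "(a @ u @ b, a @ v @ b) \<in> presentation_rel X R"
  using assms
proof (induction rule: presentation_rel.induct)
  case (refl u)
  then show ?case by (intro presentation_rel.refl) auto
next
  case (sym u v)
  then show ?case by (auto intro: presentation_rel.sym)
next
  case (trans u v w)
  then show ?case by (auto intro: presentation_rel.trans)
next
  case (cancel u v x c)
  then show ?case
    using presentation_rel.cancel[of "a @ u" X "v @ b" x c R] by auto
next
  case (relator u v r)
  then show ?case
    using presentation_rel.relator[of "a @ u" X "v @ b" r R] by auto
qed

lemma presentation_rel_append:
  assumes "(u, u') \<in> presentation_rel X R" "(v, v') \<in> presentation_rel X R"
  shows "(u @ v, u' @ v') \<in> presentation_rel X R"
proof -
  have "(u @ v, u' @ v) \<in> presentation_rel X R"
    using presentation_rel_context[OF assms(1), of "[]" v] presentation_rel_swords[OF assms(2)]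
    by auto
  moreover have "(u' @ v, u' @ v') \<in> presentation_rel X R"
    using presentation_rel_context[OF assms(2), of u' "[]"] presentation_rel_swords[OF assms(1)]
    by auto
  ultimately show ?thesis by (rule presentation_rel.trans)
qed

lemma presented_mult:
  assumes "u \<in> swords X" "v \<in> swords X"
  shows "(presentation_rel X R `` {u}) \<otimes>\<^bsub>presented_group X R\<^esub> (presentation_rel X R `` {v})
    = presentation_rel X R `` {u @ v}"
proof -
  let ?r = "presentation_rel X R"
  have *: "?r `` {u' @ v'} = ?r `` {u @ v}" if "(u, u') \<in> ?r" "(v, v') \<in> ?r" for u' v'
    using equiv_class_eq[OF equiv_presentation_rel presentation_rel_append[OF that]] by simp
  have "(\<Union>u'\<in>?r `` {u}. \<Union>v'\<in>?r `` {v}. ?r `` {u' @ v'}) =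
      (\<Union>u'\<in>?r `` {u}. \<Union>v'\<in>?r `` {v}. ?r `` {u @ v})"
    by (intro SUP_cong *) auto
  also have "\<dots> = ?r `` {u @ v}"
    using presentation_rel.refl[OF assms(1), of R] presentation_rel.refl[OF assms(2), of R]
    by blast
  finally show ?thesis by (simp add: presented_group_def)
qed

lemma presented_carrierE:
  assumes "A \<in> carrier (presented_group X R)"
  obtains u where "u \<in> swords X" "A = presentation_rel X R `` {u}"
  using assms quotientE[of A "swords X" "presentation_rel X R"]
  by (simp add: presented_group_def) metis

lemma presented_carrierI:
  assumes "u \<in> swords X"
  shows "presentation_rel X R `` {u} \<in> carrier (presented_group X R)"
  using assms by (auto simp: presented_group_def intro: quotientI)

lemma presented_left_inverse:
  assumes "u \<in> swords X"
  shows "\<exists>v\<in>swords X. (v @ u, []) \<in> presentation_rel X R"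
  using assms
proof (induction u)
  case Nil
  then show ?case by (auto intro!: bexI[of _ "[]"] presentation_rel.refl)
next
  case (Cons p u)
  then obtain v where v: "v \<in> swords X" "(v @ u, []) \<in> presentation_rel X R" by auto
  obtain x b where p: "p = (x, b)" by force
  have "(v @ [(x, \<not> b), (x, \<not> \<not> b)] @ u, v @ u) \<in> presentation_rel X R"
    using Cons.hyps v(1) p by (intro presentation_rel.cancel) auto
  then have "((v @ [(x, \<not> b)]) @ p # u, []) \<in> presentation_rel X R"
    using v(2) p by (auto intro: presentation_rel.trans)
  moreover have "v @ [(x, \<not> b)] \<in> swords X" using v(1) Cons.hyps p by auto
  ultimately show ?case by blast
qed

lemma group_presented_group: "group (presented_group X R)"
proof (rule groupI)
  let ?r = "presentation_rel X R" and ?G = "presented_group X R"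
  have one: "\<one>\<^bsub>?G\<^esub> = ?r `` {[]}" by (simp add: presented_group_def)
  show "\<one>\<^bsub>?G\<^esub> \<in> carrier ?G" unfolding one by (rule presented_carrierI) simp
  fix A assume A: "A \<in> carrier ?G"
  then obtain u where u: "u \<in> swords X" "A = ?r `` {u}" by (rule presented_carrierE)
  show "\<one>\<^bsub>?G\<^esub> \<otimes>\<^bsub>?G\<^esub> A = A" unfolding one u(2) using u(1) by (subst presented_mult) auto
  obtain v where v: "v \<in> swords X" "(v @ u, []) \<in> ?r" using presented_left_inverse[OF u(1)] by blast
  have "(?r `` {v}) \<otimes>\<^bsub>?G\<^esub> A = \<one>\<^bsub>?G\<^esub>" unfolding one u(2)
    using u(1) v equiv_class_eq[OF equiv_presentation_rel v(2)] by (subst presented_mult) auto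
  then show "\<exists>B\<in>carrier ?G. B \<otimes>\<^bsub>?G\<^esub> A = \<one>\<^bsub>?G\<^esub>" using v(1) presented_carrierI by blast
  fix B assume "B \<in> carrier ?G"
  then obtain v where v: "v \<in> swords X" "B = ?r `` {v}" by (rule presented_carrierE)
  show "A \<otimes>\<^bsub>?G\<^esub> B \<in> carrier ?G" unfolding u(2) v(2)
    using u(1) v(1) by (subst presented_mult) (auto intro!: presented_carrierI)
  fix C assume "C \<in> carrier ?G"
  then obtain w where w: "w \<in> swords X" "C = ?r `` {w}" by (rule presented_carrierE)
  show "A \<otimes>\<^bsub>?G\<^esub> B \<otimes>\<^bsub>?G\<^esub> C = A \<otimes>\<^bsub>?G\<^esub> (B \<otimes>\<^bsub>?G\<^esub> C)"
    unfolding u(2) v(2) w(2) using u(1) v(1) w(1)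
    by (simp add: presented_mult)
qed

lemma group_coxeter_group: "group (coxeter_group I m)"
  unfolding coxeter_group_def by (rule group_presented_group)

lemma coxeter_gen_closed: "i \<in> I \<Longrightarrow> coxeter_gen I m i \<in> carrier (coxeter_group I m)"
  unfolding coxeter_gen_def coxeter_group_def by (rule presented_carrierI) auto

lemma word_elt_class:
  assumes "f \<in> lists I"
  shows "word_elt I m f =
    presentation_rel I (coxeter_relators I m) `` {map (\<lambda>i. (i, True)) f}"
  using assms
proof (induction f)
  case Nil
  then show ?case by (simp add: word_elt_def coxeter_group_def presented_group_def)
next
  case (Cons i f)
  have "word_elt I m (i # f) = coxeter_gen I m i \<otimes>\<^bsub>coxeter_group I m\<^esub> word_elt I m f"
    by (simp add: word_elt_def)
  also have "\<dots> = presentation_rel I (coxeter_relators I m) ``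
      {[(i, True)] @ map (\<lambda>i. (i, True)) f}"
    unfolding Cons.IH coxeter_gen_def coxeter_group_def
    using Cons.hyps by (intro presented_mult) auto
  finally show ?case by simp
qed

lemma word_elt_closed: "f \<in> lists I \<Longrightarrow> word_elt I m f \<in> carrier (coxeter_group I m)"
  unfolding coxeter_group_def by (subst word_elt_class) (auto intro!: presented_carrierI)

lemma word_elt_snoc:
  assumes "f \<in> lists I" "i \<in> I"
  shows "word_elt I m (f @ [i]) = word_elt I m f \<otimes>\<^bsub>coxeter_group I m\<^esub> coxeter_gen I m i"
proof -
  have "word_elt I m (f @ [i]) =
      presentation_rel I (coxeter_relators I m) `` {map (\<lambda>i. (i, True)) f @ [(i, True)]}"
    using assms by (subst word_elt_class) auto
  also have "\<dots> = word_elt I m f \<otimes>\<^bsub>coxeter_group I m\<^esub> coxeter_gen I m i"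
    unfolding coxeter_gen_def coxeter_group_def word_elt_class[OF assms(1)]
    using assms by (subst presented_mult) auto
  finally show ?thesis .
qed

lemma coxeter_relator_square:
  assumes "coxeter_matrix I m" "i \<in> I"
  shows "[(i, True), (i, True)] \<in> coxeter_relators I m"
proof -
  have "m i i = enat 1" using assms by (simp add: coxeter_matrix_def one_enat_def)
  moreover have "[(i, True), (i, True)] = concat (replicate 1 [(i, True), (i, True)])" by simp
  ultimately show ?thesis unfolding coxeter_relators_def using assms(2) by blast
qed

lemma sword_positive:
  assumes "coxeter_matrix I m" "u \<in> swords I"
  shows "\<exists>f\<in>lists I. (u, map (\<lambda>i. (i, True)) f) \<in> presentation_rel I (coxeter_relators I m)"
  using assms(2)
proof (induction u)
  case Nil
  then show ?case by (auto intro!: bexI[of _ "[]"] presentation_rel.refl)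
next
  case (Cons p u)
  let ?r = "presentation_rel I (coxeter_relators I m)"
  obtain i b where p: "p = (i, b)" by force
  have i: "i \<in> I" using Cons.hyps p by auto
  have "([(i, b)], [(i, True)]) \<in> ?r"
  proof (cases b)
    case True
    then show ?thesis using i by (auto intro!: presentation_rel.refl)
  next
    case False
    have "([(i, False)] @ [(i, True), (i, True)] @ [], [(i, False)] @ []) \<in> ?r"
      using i coxeter_relator_square[OF assms(1) i] by (intro presentation_rel.relator) auto
    moreover have "([] @ [(i, False), (i, \<not> False)] @ [(i, True)], [] @ [(i, True)]) \<in> ?r"
      using i by (intro presentation_rel.cancel) auto
    ultimately show ?thesis
      using False by (auto intro: presentation_rel.trans presentation_rel.sym)
  qed
  moreover obtain f where f: "f \<in> lists I" "(u, map (\<lambda>i. (i, True)) f) \<in> ?r" using Cons by auto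
  ultimately have "([(i, b)] @ u, [(i, True)] @ map (\<lambda>i. (i, True)) f) \<in> ?r"
    by (intro presentation_rel_append)
  then show ?case using f(1) i p by (intro bexI[of _ "i # f"]) auto
qed

lemma word_elt_surj:
  assumes "coxeter_matrix I m" "w \<in> carrier (coxeter_group I m)"
  obtains f where "f \<in> lists I" "word_elt I m f = w"
proof -
  obtain u where u: "u \<in> swords I" "w = presentation_rel I (coxeter_relators I m) `` {u}"
    using assms(2) unfolding coxeter_group_def by (rule presented_carrierE)
  obtain f where f: "f \<in> lists I"
    "(u, map (\<lambda>i. (i, True)) f) \<in> presentation_rel I (coxeter_relators I m)"
    using sword_positive[OF assms(1) u(1)] by blast
  have "word_elt I m f = w"
    using f equiv_class_eq[OF equiv_presentation_rel f(2)] u(2) by (simp add: word_elt_class)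
  then show thesis using f(1) that by blast
qed

lemma coxeter_length_witness:
  assumes "coxeter_matrix I m" "w \<in> carrier (coxeter_group I m)"
  obtains f where "f \<in> lists I" "length f = coxeter_length I m w" "word_elt I m f = w"
proof -
  obtain f where "f \<in> lists I" "word_elt I m f = w" using word_elt_surj[OF assms] .
  then have "\<exists>n. \<exists>f\<in>lists I. length f = n \<and> word_elt I m f = w" by blast
  then have "\<exists>f\<in>lists I. length f = coxeter_length I m w \<and> word_elt I m f = w"
    unfolding coxeter_length_def by (rule LeastI_ex)
  then show thesis using that by blast
qed

lemma coxeter_length_le: "f \<in> lists I \<Longrightarrow> coxeter_length I m (word_elt I m f) \<le> length f"
  unfolding coxeter_length_def by (rule Least_le) blast

lemma presentation_rel_parity:
  assumes "(u, v) \<in> presentation_rel I (coxeter_relators I m)"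
  shows "even (length u) \<longleftrightarrow> even (length v)"
proof -
  have "even (length (concat (replicate k [(i, True), (j, True)])))" for k and i j :: 'a
    by (induction k) auto
  then have "even (length r)" if "r \<in> coxeter_relators I m" for r
    using that unfolding coxeter_relators_def by blast
  with assms show ?thesis
    by (induction rule: presentation_rel.induct) auto
qed

lemma word_elt_parity:
  assumes "f \<in> lists I" "g \<in> lists I" "word_elt I m f = word_elt I m g"
  shows "even (length f) \<longleftrightarrow> even (length g)"
proof -
  have "(map (\<lambda>i. (i, True)) f, map (\<lambda>i. (i, True)) g)
      \<in> presentation_rel I (coxeter_relators I m)"
    using assms
    by (intro eq_equiv_class[OF _ equiv_presentation_rel]) (auto simp: word_elt_class)
  from presentation_rel_parity[OF this] show ?thesis by simp
qed

lemma coxeter_gen_mult_self: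
  assumes "coxeter_matrix I m" "i \<in> I"
  shows "coxeter_gen I m i \<otimes>\<^bsub>coxeter_group I m\<^esub> coxeter_gen I m i = \<one>\<^bsub>coxeter_group I m\<^esub>"
proof -
  have "([] @ [(i, True), (i, True)] @ [], [] @ []) \<in> presentation_rel I (coxeter_relators I m)"
    using assms(2) coxeter_relator_square[OF assms] by (intro presentation_rel.relator) auto
  from equiv_class_eq[OF equiv_presentation_rel this] show ?thesis
    unfolding coxeter_gen_def coxeter_group_def using assms(2)
    by (subst presented_mult) (auto simp: presented_group_def)
qed

lemma coxeter_length_mult_gen:
  assumes m: "coxeter_matrix I m" and w: "w \<in> carrier (coxeter_group I m)"
    and s: "s \<in> coxeter_gen I m ` I"
  defines "ws \<equiv> w \<otimes>\<^bsub>coxeter_group I m\<^esub> s"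
  shows "coxeter_length I m ws = coxeter_length I m w + 1 \<or>
    int (coxeter_length I m ws) = int (coxeter_length I m w) - 1"
proof -
  interpret G: group "coxeter_group I m" by (rule group_coxeter_group)
  obtain i where i: "i \<in> I" "s = coxeter_gen I m i" using s by blast
  have sc: "s \<in> carrier (coxeter_group I m)" using i coxeter_gen_closed by simp
  have wsc: "ws \<in> carrier (coxeter_group I m)" unfolding ws_def using w sc by simp
  have ws_s: "ws \<otimes>\<^bsub>coxeter_group I m\<^esub> s = w"
    unfolding ws_def using w sc coxeter_gen_mult_self[OF m i(1)] i(2) by (simp add: G.m_assoc)
  obtain f where f: "f \<in> lists I" "length f = coxeter_length I m w" "word_elt I m f = w"
    using coxeter_length_witness[OF m w] .
  obtain g where g: "g \<in> lists I" "length g = coxeter_length I m ws" "word_elt I m g = ws"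
    using coxeter_length_witness[OF m wsc] .
  have f': "word_elt I m (f @ [i]) = ws" using word_elt_snoc[OF f(1) i(1)] f(3) i(2) ws_def by simp
  have g': "word_elt I m (g @ [i]) = w" using word_elt_snoc[OF g(1) i(1)] g(3) i(2) ws_s by simp
  have "coxeter_length I m ws \<le> length f + 1"
    using coxeter_length_le[of "f @ [i]" I m] f f' i by auto
  moreover have "coxeter_length I m w \<le> length g + 1"
    using coxeter_length_le[of "g @ [i]" I m] g g' i by auto
  moreover have "even (length (f @ [i])) \<longleftrightarrow> even (length g)"
    using f g f' i by (intro word_elt_parity[of _ I _ m]) auto
  then have "coxeter_length I m ws \<noteq> coxeter_length I m w" using f g by auto
  ultimately show ?thesis using f g by linarith
qed

lemma reduced_snocD:
  assumes m: "coxeter_matrix I m" and r: "reduced I m (f @ [i])"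
  shows "reduced I m f"
    "coxeter_length I m (word_elt I m f \<otimes>\<^bsub>coxeter_group I m\<^esub> coxeter_gen I m i)
      = coxeter_length I m (word_elt I m f) + 1"
proof -
  have fi: "f \<in> lists I" "i \<in> I" using r by (auto simp: reduced_def)
  let ?w = "word_elt I m f"
  have eq: "coxeter_length I m (?w \<otimes>\<^bsub>coxeter_group I m\<^esub> coxeter_gen I m i) = length f + 1"
    using r unfolding reduced_def word_elt_snoc[OF fi] by simp
  have "coxeter_length I m ?w \<le> length f" by (rule coxeter_length_le[OF fi(1)])
  moreover have "length f + 1 \<le> coxeter_length I m ?w + 1"
    using coxeter_length_mult_gen[OF m word_elt_closed[OF fi(1)], of "coxeter_gen I m i"] fi eq
    by auto
  ultimately show "reduced I m f" "coxeter_length I m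
      (?w \<otimes>\<^bsub>coxeter_group I m\<^esub> coxeter_gen I m i) = coxeter_length I m ?w + 1"
    using fi eq unfolding reduced_def by linarith+
qed

lemma reduced_word_exists:
  assumes "coxeter_matrix I m" "w \<in> carrier (coxeter_group I m)"
  obtains f where "reduced I m f" "word_elt I m f = w"
  using coxeter_length_witness[OF assms] by (metis reduced_def)

lemma module_scale_op: "Modules.module scale_op"
  by unfold_locales (auto simp: scale_op_def fun_eq_iff algebra_simps)

lemma hecke_T_closed:
  "w \<in> carrier (coxeter_group I m) \<Longrightarrow> hecke_T w \<in> carrier (hecke_structure I m M)"
  by (auto simp: hecke_structure_def hecke_T_def)

lemma hecke_carrier_induct:
  assumes "x \<in> carrier (hecke_structure I m M)"
    and zero: "P (\<lambda>v. 0)"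
    and step: "\<And>k w y. w \<in> carrier (coxeter_group I m) \<Longrightarrow>
      y \<in> carrier (hecke_structure I m M) \<Longrightarrow> P y \<Longrightarrow> P (\<lambda>v. k * hecke_T w v + y v)"
  shows "P x"
proof -
  have "P x" if "finite F" "F \<subseteq> carrier (coxeter_group I m)" "{w. x w \<noteq> 0} \<subseteq> F" for F x
    using that
  proof (induction F arbitrary: x)
    case empty
    then have "x = (\<lambda>v. 0)" by auto
    then show ?case using zero by simp
  next
    case (insert w F)
    let ?y = "x(w := 0)"
    have supp: "{v. ?y v \<noteq> 0} \<subseteq> F" using insert.prems by auto
    then have "?y \<in> carrier (hecke_structure I m M)"
      using insert by (auto simp: hecke_structure_def intro: finite_subset simp del: fun_upd_apply)
    moreover have "P ?y" using insert supp by auto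
    ultimately have "P (\<lambda>v. x w * hecke_T w v + ?y v)" using insert.prems by (intro step) (simp_all del: fun_upd_apply)
    moreover have "(\<lambda>v. x w * hecke_T w v + ?y v) = x" by (auto simp: hecke_T_def)
    ultimately show ?case by simp
  qed
  then show ?thesis using assms(1) by (auto simp: hecke_structure_def)
qed

lemma hecke_structure_simps:
  "monoid.mult (hecke_structure I m M) = M"
  "\<one>\<^bsub>hecke_structure I m M\<^esub> = hecke_T \<one>\<^bsub>coxeter_group I m\<^esub>"
  "\<zero>\<^bsub>hecke_structure I m M\<^esub> = (\<lambda>v. 0)"
  "x \<oplus>\<^bsub>hecke_structure I m M\<^esub> y = (\<lambda>v. x v + y v)"
  "k \<odot>\<^bsub>hecke_structure I m M\<^esub> x = (\<lambda>v. k * x v)"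
  by (auto simp: hecke_structure_def fun_eq_iff)

lemma hecke_smult_closed:
  assumes "x \<in> carrier (hecke_structure I m M)"
  shows "(\<lambda>v. k * x v) \<in> carrier (hecke_structure I m M)"
  using assms by (auto simp: hecke_structure_def elim!: rev_finite_subset)

lemma hecke_product_linear:
  assumes "complex_algebra (hecke_structure I m M)"
    and x: "x \<in> carrier (hecke_structure I m M)" and y: "y \<in> carrier (hecke_structure I m M)"
    and z: "z \<in> carrier (hecke_structure I m M)"
  shows "M (\<lambda>v. k * x v + y v) z = (\<lambda>v. k * M x z v + M y z v)"
    "M z (\<lambda>v. k * x v + y v) = (\<lambda>v. k * M z x v + M z y v)"
    "M (\<lambda>v. 0) z = (\<lambda>v. 0)" "M z (\<lambda>v. 0) = (\<lambda>v. 0)"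
proof -
  let ?H = "hecke_structure I m M"
  interpret R: ring ?H using assms(1) by (simp add: complex_algebra_def)
  note [simp] = hecke_structure_simps
  have *: "(k \<odot>\<^bsub>?H\<^esub> x) \<otimes>\<^bsub>?H\<^esub> z = k \<odot>\<^bsub>?H\<^esub> (x \<otimes>\<^bsub>?H\<^esub> z)"
      "z \<otimes>\<^bsub>?H\<^esub> (k \<odot>\<^bsub>?H\<^esub> x) = k \<odot>\<^bsub>?H\<^esub> (z \<otimes>\<^bsub>?H\<^esub> x)"
    using assms by (auto simp: complex_algebra_def simp del: hecke_structure_simps)
  have c: "k \<odot>\<^bsub>?H\<^esub> x \<in> carrier ?H" using hecke_smult_closed[OF x] by simp
  show "M (\<lambda>v. k * x v + y v) z = (\<lambda>v. k * M x z v + M y z v)"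
    using R.l_distr[OF c y z] *(1) by simp
  show "M z (\<lambda>v. k * x v + y v) = (\<lambda>v. k * M z x v + M z y v)"
    using R.r_distr[OF c y z] *(2) by simp
  show "M (\<lambda>v. 0) z = (\<lambda>v. 0)" "M z (\<lambda>v. 0) = (\<lambda>v. 0)"
    using R.l_null[OF z] R.r_null[OF z] by simp_all
qed

lemma hecke_product_unique:
  assumes m: "coxeter_matrix I m"
    and M: "is_hecke_product I m a b M" and N: "is_hecke_product I m a b N"
    and x: "x \<in> carrier (hecke_structure I m M)" and y: "y \<in> carrier (hecke_structure I m M)"
  shows "M x y = N x y"
proof -
  let ?G = "coxeter_group I m" and ?C = "carrier (hecke_structure I m M)"
  have C: "carrier (hecke_structure I m N) = ?C" by (simp add: hecke_structure_def)
  have algM: "complex_algebra (hecke_structure I m M)" and algN: "complex_algebra (hecke_structure I m N)"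
    using M N by (auto simp: is_hecke_product_def)
  interpret RM: ring "hecke_structure I m M" using algM by (simp add: complex_algebra_def)
  interpret RN: ring "hecke_structure I m N" using algN by (simp add: complex_algebra_def)
  note linM = hecke_product_linear[OF algM]
  note linN = hecke_product_linear[OF algN, unfolded C]
  note relM = M[unfolded is_hecke_product_def Let_def hecke_structure_simps, THEN conjunct2, THEN conjunct2]
  note relN = N[unfolded is_hecke_product_def Let_def hecke_structure_simps, THEN conjunct2, THEN conjunct2]
  have Ms: "M (hecke_T w) (hecke_T s) = N (hecke_T w) (hecke_T s)"
    if "w \<in> carrier ?G" "s \<in> coxeter_gen I m ` I" for w s
    using relM[rule_format, OF that] relN[rule_format, OF that] coxeter_length_mult_gen[OF m that]
    by auto
  have zs: "M z (hecke_T s) = N z (hecke_T s)" if z: "z \<in> ?C" and s: "s \<in> coxeter_gen I m ` I" for z s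
  proof -
    have Ts: "hecke_T s \<in> ?C" using s coxeter_gen_closed by (intro hecke_T_closed) auto
    show ?thesis using z
    proof (rule hecke_carrier_induct)
      show "M (\<lambda>v. 0) (hecke_T s) = N (\<lambda>v. 0) (hecke_T s)"
        using linM(3)[OF Ts Ts Ts] linN(3)[OF Ts Ts Ts] by simp
      fix k w y assume "w \<in> carrier ?G" "y \<in> ?C" "M y (hecke_T s) = N y (hecke_T s)"
      then show "M (\<lambda>v. k * hecke_T w v + y v) (hecke_T s) = N (\<lambda>v. k * hecke_T w v + y v) (hecke_T s)"
        using linM(1)[OF hecke_T_closed _ Ts] linN(1)[OF hecke_T_closed _ Ts] Ms[OF _ s] by simp
    qed
  qed
  have red: "M x (hecke_T (word_elt I m f)) = N x (hecke_T (word_elt I m f))"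
    if "x \<in> ?C" "reduced I m f" for x f
    using that(2)
  proof (induction f rule: rev_induct)
    case Nil
    have "word_elt I m [] = \<one>\<^bsub>?G\<^esub>" by (simp add: word_elt_def)
    then show ?case
      using RM.r_one[OF that(1)] RN.r_one[unfolded C, OF that(1)] by (simp add: hecke_structure_simps)
  next
    case (snoc i f)
    have fi: "f \<in> lists I" "i \<in> I" using snoc.prems by (auto simp: reduced_def)
    let ?w = "word_elt I m f" and ?s = "coxeter_gen I m i"
    have w: "?w \<in> carrier ?G" and s: "?s \<in> coxeter_gen I m ` I" using word_elt_closed[OF fi(1)] fi(2) by auto
    have Tw: "hecke_T ?w \<in> ?C" using w by (rule hecke_T_closed)
    have Ts: "hecke_T ?s \<in> ?C" using fi coxeter_gen_closed by (intro hecke_T_closed) auto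
    note red = reduced_snocD[OF m snoc.prems]
    have T: "hecke_T (word_elt I m (f @ [i])) = M (hecke_T ?w) (hecke_T ?s)"
      "hecke_T (word_elt I m (f @ [i])) = N (hecke_T ?w) (hecke_T ?s)"
      using relM[rule_format, OF w s] relN[rule_format, OF w s] red(2) word_elt_snoc[OF fi] by auto
    have cl: "N x (hecke_T ?w) \<in> ?C"
      using RN.m_closed[unfolded C, OF that(1) Tw] by (simp add: hecke_structure_simps)
    have "M x (M (hecke_T ?w) (hecke_T ?s)) = M (M x (hecke_T ?w)) (hecke_T ?s)"
      using RM.m_assoc[OF that(1) Tw Ts] by (simp add: hecke_structure_simps)
    also have "\<dots> = N (N x (hecke_T ?w)) (hecke_T ?s)"
      using snoc.IH[OF red(1)] zs[OF cl s] by simp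
    also have "\<dots> = N x (N (hecke_T ?w) (hecke_T ?s))"
      using RN.m_assoc[unfolded C, OF that(1) Tw Ts] by (simp add: hecke_structure_simps)
    finally show ?case using T by simp
  qed
  show ?thesis using y
  proof (rule hecke_carrier_induct)
    show "M x (\<lambda>v. 0) = N x (\<lambda>v. 0)" using linM(4)[OF x x x] linN(4)[OF x x x] by simp
    fix k w y assume w: "w \<in> carrier ?G" and y: "y \<in> ?C" and IH: "M x y = N x y"
    obtain f where "reduced I m f" "word_elt I m f = w" using reduced_word_exists[OF m w] .
    then have "M x (hecke_T w) = N x (hecke_T w)" using red[OF x] by blast
    then show "M x (\<lambda>v. k * hecke_T w v + y v) = N x (\<lambda>v. k * hecke_T w v + y v)"
      using linM(2)[OF hecke_T_closed[OF w] y x] linN(2)[OF hecke_T_closed[OF w] y x] IH by simp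
  qed
qed

end

theory Submission
  imports Defs
begin

text \<open>The operators \<open>B\<^sub>w\<close> satisfy the Hecke relations: for \<open>\<ell>(ws) > \<ell>(w)\<close> the sphere
  \<open>\<C>\<^sub>w\<^sub>s(c)\<close> is the disjoint union of the spheres \<open>\<C>\<^sub>s(d)\<close>, \<open>d \<in> \<C>\<^sub>w(c)\<close>, so \<open>B\<^sub>w B\<^sub>s = B\<^sub>w\<^sub>s\<close>;
  the descending case reduces to the quadratic relation for \<open>B\<^sub>s\<close>, which is a count inside a panel.
  They are linearly independent because the spheres around a chamber are nonempty and disjoint.
  Hence composition of operators, transported to the finitely supported functions on \<open>W\<close>, is a
  Hecke product; as such a product is unique, the Hecke algebra is the transported algebra.\<close>

section \<open>Galleries and spheres\<close>

lemma joined_Nil: "joined adj [] c d \<longleftrightarrow> c = d"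
  unfolding joined_def gallery_def by (auto simp: length_Suc_conv intro!: exI[of _ "[c]"])

text \<open>Galleries are split at their last step because the Hecke relations multiply by a
  generator on the right; inductions over words accordingly remove the last letter.\<close>

lemma joined_snoc:
  "joined adj (f @ [i]) c d \<longleftrightarrow> (\<exists>e. joined adj f c e \<and> (e, d) \<in> adj i \<and> e \<noteq> d)"
proof
  assume "joined adj (f @ [i]) c d"
  then obtain cs where cs: "gallery adj (f @ [i]) cs" "hd cs = c" "last cs = d"
    by (auto simp: joined_def)
  have len: "length cs = Suc (Suc (length f))" using cs(1) by (simp add: gallery_def)
  have step: "(cs ! k, cs ! Suc k) \<in> adj ((f @ [i]) ! k) \<and> cs ! k \<noteq> cs ! Suc k"
    if "k < Suc (length f)" for k
    using cs(1) that by (auto simp: gallery_def)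
  have "gallery adj f (butlast cs)"
    unfolding gallery_def
  proof (intro conjI allI impI)
    fix k assume k: "k < length f"
    then have "butlast cs ! k = cs ! k" "butlast cs ! Suc k = cs ! Suc k"
      by (simp_all add: nth_butlast len)
    with step[of k] k show "(butlast cs ! k, butlast cs ! Suc k) \<in> adj (f ! k)"
      "butlast cs ! k \<noteq> butlast cs ! Suc k"
      by (auto simp: nth_append)
  qed (simp add: len)
  moreover have ne: "butlast cs \<noteq> []" "cs \<noteq> []" using len by (auto simp flip: length_greater_0_conv)
  moreover have "hd (butlast cs) = c" using ne cs(2) by (cases cs) (auto split: if_splits)
  ultimately have "joined adj f c (last (butlast cs))" by (auto simp: joined_def)
  moreover have "last (butlast cs) = cs ! length f"
    using ne by (simp add: last_conv_nth nth_butlast len)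
  moreover have "d = cs ! Suc (length f)" using ne cs(3) by (simp add: last_conv_nth len)
  ultimately show "\<exists>e. joined adj f c e \<and> (e, d) \<in> adj i \<and> e \<noteq> d"
    using step[of "length f"] by auto
next
  assume "\<exists>e. joined adj f c e \<and> (e, d) \<in> adj i \<and> e \<noteq> d"
  then obtain e cs where *: "gallery adj f cs" "hd cs = c" "last cs = e" "(e, d) \<in> adj i" "e \<noteq> d"
    by (auto simp: joined_def)
  have len: "length cs = Suc (length f)" using *(1) by (simp add: gallery_def)
  have e: "cs ! length f = e" using *(3) len by (cases cs rule: rev_cases) (auto simp: nth_append)
  have "gallery adj (f @ [i]) (cs @ [d])"
    unfolding gallery_def
  proof (intro conjI allI impI)
    fix k assume "k < length (f @ [i])"
    then consider "k < length f" | "k = length f" by fastforce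
    then show "((cs @ [d]) ! k, (cs @ [d]) ! Suc k) \<in> adj ((f @ [i]) ! k)"
      "(cs @ [d]) ! k \<noteq> (cs @ [d]) ! Suc k"
      using * len e by (cases; auto simp: gallery_def nth_append)+
  qed (simp add: len)
  moreover have "hd (cs @ [d]) = c" using *(2) len by (cases cs) auto
  ultimately show "joined adj (f @ [i]) c d" by (auto simp: joined_def)
qed

section \<open>Short reduced words and extension by one letter\<close>

lemma reduced_Nil: "reduced I m []"
  using coxeter_length_le[of "[]" I m] by (simp add: reduced_def)

text \<open>All relators have even length, so a single letter never spells the identity. Hence a
  shortest word for it has odd length at most one.\<close>

lemma reduced_singleton:
  assumes "coxeter_matrix I m" "i \<in> I"
  shows "reduced I m [i]"
proof -
  have i: "[i] \<in> lists I" using assms(2) by simp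
  obtain f where f: "f \<in> lists I" "length f = coxeter_length I m (word_elt I m [i])"
      "word_elt I m f = word_elt I m [i]"
    using coxeter_length_witness[OF assms(1) word_elt_closed[OF i]] .
  have "odd (length f)" using word_elt_parity[OF f(1) i f(3)] by simp
  moreover have "length f \<le> 1" using coxeter_length_le[OF i] f(2) by simp
  ultimately have "length f = 1" by (cases "length f") auto
  then show ?thesis using i f(2) by (simp add: reduced_def)
qed

lemma word_elt_Nil: "word_elt I m [] = \<one>\<^bsub>coxeter_group I m\<^esub>"
  by (simp add: word_elt_def)

lemma word_elt_Cons:
  "word_elt I m (i # f) = coxeter_gen I m i \<otimes>\<^bsub>coxeter_group I m\<^esub> word_elt I m f"
  by (simp add: word_elt_def)

lemma word_elt_singleton: "i \<in> I \<Longrightarrow> word_elt I m [i] = coxeter_gen I m i"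
  by (simp add: word_elt_class coxeter_gen_def)

lemma reduced_snocI:
  assumes "reduced I m f" "i \<in> I"
    and "coxeter_length I m (word_elt I m f \<otimes>\<^bsub>coxeter_group I m\<^esub> coxeter_gen I m i)
      = coxeter_length I m (word_elt I m f) + 1"
  shows "reduced I m (f @ [i])"
  using assms by (simp add: reduced_def word_elt_snoc)

lemma mem_chamber_sphere: "d \<in> chamber_sphere \<delta> w c \<longleftrightarrow> \<delta> c d = w"
  by (simp add: chamber_sphere_def)

locale regular_building =
  fixes I :: "'i set"
    and m :: "'i \<Rightarrow> 'i \<Rightarrow> enat"
    and adj :: "'i \<Rightarrow> ('c \<times> 'c) set"
    and \<delta> :: "'c \<Rightarrow> 'c \<Rightarrow> 'i sword set"
    and q :: "'i sword set \<Rightarrow> nat"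
  assumes building: "building I m adj \<delta>"
    and locally_finite: "locally_finite I adj"
    and regular: "regular_with_parameters I m \<delta> q"
begin

abbreviation G where "G \<equiv> coxeter_group I m"
abbreviation gen where "gen \<equiv> coxeter_gen I m"
abbreviation len where "len \<equiv> coxeter_length I m"
abbreviation sphere where "sphere \<equiv> chamber_sphere \<delta>"
abbreviation op where "op \<equiv> averaging_op I m \<delta> q"

sublocale G: group G by (rule group_coxeter_group)

lemma matrix: "coxeter_matrix I m"
  using building by (simp add: building_def)

lemma equiv_adj: "i \<in> I \<Longrightarrow> equiv UNIV (adj i)"
  using building by (simp add: building_def chamber_system_def)

section \<open>The Weyl distance along one gallery step\<close>

lemma delta_reduced: "reduced I m f \<Longrightarrow> \<delta> c d = word_elt I m f \<longleftrightarrow> joined adj f c d"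
  using building by (auto simp: building_def)

lemma delta_eq_one: "\<delta> c d = \<one>\<^bsub>G\<^esub> \<longleftrightarrow> c = d"
  using delta_reduced[OF reduced_Nil] by (simp add: word_elt_Nil joined_Nil)

lemma delta_eq_gen: "i \<in> I \<Longrightarrow> \<delta> c d = gen i \<longleftrightarrow> (c, d) \<in> adj i \<and> c \<noteq> d"
  using delta_reduced[OF reduced_singleton[OF matrix], of i c d] joined_snoc[of adj "[]" i c d]
  by (simp add: word_elt_singleton joined_Nil)

text \<open>Appending \<open>i\<close> to a reduced word of \<open>w\<close> keeps it reduced, so
  the second building axiom applies to both words and the longer gallery can be cut before its last
  step.\<close>

lemma delta_ascent:
  assumes w: "w \<in> carrier G" and i: "i \<in> I" and "len (w \<otimes>\<^bsub>G\<^esub> gen i) = len w + 1"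
  shows "\<delta> c d = w \<otimes>\<^bsub>G\<^esub> gen i \<longleftrightarrow> (\<exists>e. \<delta> c e = w \<and> \<delta> e d = gen i)"
proof -
  obtain f where f: "reduced I m f" "word_elt I m f = w"
    using reduced_word_exists[OF matrix w] .
  have "reduced I m (f @ [i])" using reduced_snocI f i assms(3) by metis
  moreover have "word_elt I m (f @ [i]) = w \<otimes>\<^bsub>G\<^esub> gen i"
    using f i by (auto simp: reduced_def word_elt_snoc)
  ultimately show ?thesis
    using delta_reduced[of "f @ [i]" c d] delta_reduced[OF f(1)] f(2)
    by (auto simp: joined_snoc delta_eq_gen[OF i])
qed

section \<open>Spheres, their cardinalities and the parameters\<close>

lemma sphere_one: "sphere \<one>\<^bsub>G\<^esub> c = {c}"
  by (auto simp: mem_chamber_sphere delta_eq_one)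

lemma sphere_gen: "i \<in> I \<Longrightarrow> sphere (gen i) c = adj i `` {c} - {c}"
  by (auto simp: mem_chamber_sphere delta_eq_gen)

lemma finite_panel: "i \<in> I \<Longrightarrow> finite (adj i `` {c})"
  using locally_finite by (auto simp: locally_finite_def Image_def)

lemma finite_sphere_gen: "i \<in> I \<Longrightarrow> finite (sphere (gen i) c)"
  by (simp add: sphere_gen finite_panel)

lemma card_sphere_gen: "i \<in> I \<Longrightarrow> card (sphere (gen i) c) = q (gen i)"
  using regular by (auto simp: regular_with_parameters_def)

lemma parameter_pos:
  assumes i: "i \<in> I"
  shows "0 < q (gen i)"
proof -
  \<comment> \<open>Chambers form a type, which is nonempty, so some chamber is available.\<close>
  fix c
  obtain d where "d \<noteq> c" "(d, c) \<in> adj i" using building i unfolding building_def by blast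
  then have "d \<in> sphere (gen i) c"
    using equiv_adj[OF i] by (auto simp: sphere_gen[OF i] equiv_def dest: symD)
  then show ?thesis
    \<comment> \<open>Finiteness matters here: \<open>card\<close> is 0 on infinite sets as
      well.\<close>
    using finite_sphere_gen[OF i, of c] card_sphere_gen[OF i, of c] by (metis card_gt_0_iff empty_iff)
qed

lemma sphere_ascent:
  assumes "w \<in> carrier G" "i \<in> I" "len (w \<otimes>\<^bsub>G\<^esub> gen i) = len w + 1"
  shows "sphere (w \<otimes>\<^bsub>G\<^esub> gen i) c = (\<Union>d\<in>sphere w c. sphere (gen i) d)"
  by (rule Set.set_eqI) (simp add: mem_chamber_sphere delta_ascent[OF assms] Bex_def)

text \<open>Two distinct chambers of \<open>\<C>\<^sub>w(c)\<close> in a common \<open>i\<close>-panel would be \<open>i\<close>-adjacent, which puts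
  one of them at distance \<open>w s\<^sub>i\<close> from \<open>c\<close>.\<close>

lemma sphere_ascent_disjoint:
  assumes w: "w \<in> carrier G" and i: "i \<in> I" and l: "len (w \<otimes>\<^bsub>G\<^esub> gen i) = len w + 1"
    and d: "d \<in> sphere w c" "d' \<in> sphere w c" "d \<noteq> d'"
  shows "sphere (gen i) d \<inter> sphere (gen i) d' = {}"
proof (rule ccontr)
  assume "sphere (gen i) d \<inter> sphere (gen i) d' \<noteq> {}"
  then obtain e where "(d, e) \<in> adj i" "(d', e) \<in> adj i" by (auto simp: sphere_gen[OF i])
  then have "(d, d') \<in> adj i"
    using equiv_adj[OF i] by (meson equiv_def symD transD)
  then have "\<delta> c d' = w \<otimes>\<^bsub>G\<^esub> gen i"
    using d delta_ascent[OF w i l] delta_eq_gen[OF i] unfolding mem_chamber_sphere by blast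
  then show False using d(2) l by (auto simp: mem_chamber_sphere)
qed

text \<open>The last letter splits the sphere into disjoint spheres of equal size. Finiteness is
  proved in the same induction because counting the union needs it.\<close>

lemma card_sphere_reduced:
  assumes "reduced I m f"
  shows "finite (sphere (word_elt I m f) c) \<and>
    card (sphere (word_elt I m f) c) = prod_list (map (q \<circ> gen) f)"
  using assms
proof (induction f rule: rev_induct)
  case Nil
  then show ?case by (simp add: word_elt_Nil sphere_one)
next
  case (snoc i f)
  have fi: "f \<in> lists I" "i \<in> I" using snoc.prems by (auto simp: reduced_def)
  note red = reduced_snocD[OF matrix snoc.prems]
  note IH = snoc.IH[OF red(1)]
  have "card (\<Union>d\<in>sphere (word_elt I m f) c. sphere (gen i) d) =
      (\<Sum>d\<in>sphere (word_elt I m f) c. card (sphere (gen i) d))"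
    using IH finite_sphere_gen[OF fi(2)]
      sphere_ascent_disjoint[OF word_elt_closed[OF fi(1)] fi(2) red(2)]
    by (intro card_UN_disjoint) auto
  then show ?case
    using IH finite_sphere_gen[OF fi(2)] card_sphere_gen[OF fi(2)]
    by (simp add: word_elt_snoc[OF fi] sphere_ascent[OF word_elt_closed[OF fi(1)] fi(2) red(2)])
qed

lemma finite_sphere: "w \<in> carrier G \<Longrightarrow> finite (sphere w c)"
  using card_sphere_reduced reduced_word_exists[OF matrix] by metis

text \<open>The sphere does not refer to the reduced word that \<open>param\<close> picks, so this
  settles independence of that choice; read the other way, the sphere size does not depend on
  \<open>c\<close>.\<close>

lemma param_eq_card:
  assumes w: "w \<in> carrier G"
  shows "param I m q w = card (sphere w c)"
proof -
  let ?f = "SOME f. reduced I m f \<and> word_elt I m f = w"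
  have "\<exists>f. reduced I m f \<and> word_elt I m f = w" using reduced_word_exists[OF matrix w] by blast
  then have "reduced I m ?f \<and> word_elt I m ?f = w" by (rule someI_ex)
  then show ?thesis using card_sphere_reduced[of ?f c] by (simp add: param_def)
qed

lemma param_reduced: "reduced I m f \<Longrightarrow> param I m q (word_elt I m f) = prod_list (map (q \<circ> gen) f)"
  using card_sphere_reduced[of f] param_eq_card[of "word_elt I m f"]
  by (simp add: word_elt_closed reduced_def)

lemma param_pos:
  assumes "w \<in> carrier G"
  shows "0 < param I m q w"
proof -
  obtain f where f: "reduced I m f" "word_elt I m f = w"
    using reduced_word_exists[OF matrix assms] .
  then have "f \<in> lists I" by (simp add: reduced_def)
  then have "0 < prod_list (map (q \<circ> gen) f)" by (induction f) (auto simp: parameter_pos)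
  then show ?thesis using param_reduced[OF f(1)] f(2) by simp
qed

lemma sphere_nonempty: "w \<in> carrier G \<Longrightarrow> sphere w c \<noteq> {}"
  using param_pos param_eq_card[of w c] by fastforce

lemma param_one: "param I m q \<one>\<^bsub>G\<^esub> = 1"
  using param_reduced[OF reduced_Nil] by (simp add: word_elt_Nil)

lemma param_gen: "i \<in> I \<Longrightarrow> param I m q (gen i) = q (gen i)"
  using param_reduced[OF reduced_singleton[OF matrix], of i] by (simp add: word_elt_singleton)

lemma param_ascent:
  assumes w: "w \<in> carrier G" and i: "i \<in> I" and l: "len (w \<otimes>\<^bsub>G\<^esub> gen i) = len w + 1"
  shows "param I m q (w \<otimes>\<^bsub>G\<^esub> gen i) = param I m q w * q (gen i)"
proof -
  obtain f where f: "reduced I m f" "word_elt I m f = w"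
    using reduced_word_exists[OF matrix w] .
  have "reduced I m (f @ [i])" using reduced_snocI f i l by metis
  moreover have "word_elt I m (f @ [i]) = w \<otimes>\<^bsub>G\<^esub> gen i"
    using f i by (auto simp: reduced_def word_elt_snoc)
  ultimately show ?thesis
    using param_reduced[of "f @ [i]"] param_reduced[OF f(1)] f(2) by simp
qed

text \<open>Both \<open>f i\<close> and \<open>i' f\<close> are reduced words of \<open>w s\<^sub>i = s\<^sub>i\<^sub>' w\<close>, and they have the same parameter.\<close>

lemma parameter_conj_ascent:
  assumes w: "w \<in> carrier G" and i: "i \<in> I" "i' \<in> I"
    and l: "len (w \<otimes>\<^bsub>G\<^esub> gen i) = len w + 1"
    and eq: "gen i' \<otimes>\<^bsub>G\<^esub> w = w \<otimes>\<^bsub>G\<^esub> gen i"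
  shows "q (gen i') = q (gen i)"
proof -
  obtain f where f: "reduced I m f" "word_elt I m f = w"
    using reduced_word_exists[OF matrix w] .
  have "word_elt I m (i' # f) = w \<otimes>\<^bsub>G\<^esub> gen i" using f(2) eq by (simp add: word_elt_Cons)
  moreover have "reduced I m (i' # f)"
    using calculation f i l by (auto simp: reduced_def)
  ultimately have "param I m q (w \<otimes>\<^bsub>G\<^esub> gen i) = q (gen i') * param I m q w"
    using param_reduced[of "i' # f"] param_reduced[OF f(1)] f(2) by simp
  then show ?thesis using param_ascent[OF w i(1) l] param_pos[OF w] by simp
qed

section \<open>Parameters of generators conjugate under arbitrary elements\<close>

lemma gen_closed: "i \<in> I \<Longrightarrow> gen i \<in> carrier G"
  by (rule coxeter_gen_closed)

lemma mult_gen_gen: "w \<in> carrier G \<Longrightarrow> i \<in> I \<Longrightarrow> w \<otimes>\<^bsub>G\<^esub> gen i \<otimes>\<^bsub>G\<^esub> gen i = w"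
  by (simp add: G.m_assoc gen_closed coxeter_gen_mult_self[OF matrix])

lemma parameter_conj:
  assumes w: "w \<in> carrier G" and i: "i \<in> I" "i' \<in> I"
    and eq: "gen i' = w \<otimes>\<^bsub>G\<^esub> gen i \<otimes>\<^bsub>G\<^esub> inv\<^bsub>G\<^esub> w"
  shows "q (gen i') = q (gen i)"
proof -
  have com: "gen i' \<otimes>\<^bsub>G\<^esub> w = w \<otimes>\<^bsub>G\<^esub> gen i"
    unfolding eq using w gen_closed[OF i(1)] by (simp add: G.m_assoc)
  show ?thesis
  proof (cases "len (w \<otimes>\<^bsub>G\<^esub> gen i) = len w + 1")
    case True
    then show ?thesis using parameter_conj_ascent[OF w i _ com] by simp
  next
    case False
    \<comment> \<open>Since \<open>gen i\<close> commutes with itself, \<open>?v\<close> conjugates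
      it to the same generator as \<open>w\<close> does, and now multiplication by
      \<open>gen i\<close> increases the length.\<close>
    let ?v = "w \<otimes>\<^bsub>G\<^esub> gen i"
    have v: "?v \<in> carrier G" using w gen_closed[OF i(1)] by simp
    have "int (len ?v) = int (len w) - 1"
      using False coxeter_length_mult_gen[OF matrix w, of "gen i"] i by auto
    then have "len (?v \<otimes>\<^bsub>G\<^esub> gen i) = len ?v + 1" using mult_gen_gen[OF w i(1)] by simp
    moreover have "gen i' \<otimes>\<^bsub>G\<^esub> ?v = ?v \<otimes>\<^bsub>G\<^esub> gen i"
      using com w gen_closed i by (simp flip: G.m_assoc)
    ultimately show ?thesis using parameter_conj_ascent[OF v i] by simp
  qed
qed

lemma hecke_parameters:
  "hecke_parameters I m (\<lambda>s. inverse (of_nat (q s))) (\<lambda>s. 1 - inverse (of_nat (q s)))"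
  unfolding hecke_parameters_def using parameter_conj by fastforce


section \<open>Relations between the averaging operators\<close>

lemma op_one: "op \<one>\<^bsub>G\<^esub> = id"
  by (auto simp: fun_eq_iff averaging_op_def param_one sphere_one)

lemma op_linear: "op w (\<lambda>c. k * f c + g c) = (\<lambda>c. k * op w f c + op w g c)"
  by (auto simp: fun_eq_iff averaging_op_def sum.distrib distrib_left mult.left_commute
      simp flip: sum_distrib_left)

text \<open>Disjointness turns the double sum into one sum over the larger sphere, and
  multiplicativity of the parameters matches the normalising factors.\<close>

lemma op_ascent:
  assumes w: "w \<in> carrier G" and i: "i \<in> I" and l: "len (w \<otimes>\<^bsub>G\<^esub> gen i) = len w + 1"
  shows "op w \<circ> op (gen i) = op (w \<otimes>\<^bsub>G\<^esub> gen i)"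
proof (intro ext)
  fix f :: "'c \<Rightarrow> complex" and c
  have "(\<Sum>d\<in>sphere (w \<otimes>\<^bsub>G\<^esub> gen i) c. f d) = (\<Sum>d\<in>sphere w c. \<Sum>e\<in>sphere (gen i) d. f e)"
    unfolding sphere_ascent[OF w i l]
    using finite_sphere[OF w] finite_sphere_gen[OF i] sphere_ascent_disjoint[OF w i l]
    by (intro sum.UNION_disjoint) auto
  then show "(op w \<circ> op (gen i)) f c = op (w \<otimes>\<^bsub>G\<^esub> gen i) f c"
    by (simp add: averaging_op_def param_ascent[OF w i l] param_gen[OF i] flip: sum_divide_distrib)
qed

lemma op_gen_quadratic:
  assumes i: "i \<in> I"
  shows "op (gen i) (op (gen i) f) =
    (\<lambda>c. inverse (of_nat (q (gen i))) * f c + (1 - inverse (of_nat (q (gen i)))) * op (gen i) f c)"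
proof
  fix c
  let ?P = "adj i `` {c}" and ?q = "q (gen i)"
  have cP: "c \<in> ?P" using equiv_adj[OF i] by (auto simp: equiv_def refl_on_def)
  \<comment> \<open>All chambers of the panel \<open>?P\<close> have the same panel, so the
    \<open>i\<close>-sphere around each is \<open>?P\<close> without that chamber.\<close>
  have inner: "(\<Sum>e\<in>sphere (gen i) d. f e) = sum f ?P - f d" if "d \<in> ?P" for d
  proof -
    have "adj i `` {d} = ?P" using equiv_class_eq[OF equiv_adj[OF i]] that by auto
    then show ?thesis using sum_diff1[OF finite_panel[OF i], of f c d] that
      by (simp add: sphere_gen[OF i])
  qed
  have "(\<Sum>d\<in>sphere (gen i) c. \<Sum>e\<in>sphere (gen i) d. f e) =
      (\<Sum>d\<in>sphere (gen i) c. sum f ?P - f d)"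
    using inner by (intro sum.cong) (auto simp: sphere_gen[OF i])
  \<comment> \<open>Each of the \<open>?q\<close> chambers other than \<open>c\<close> contributes
    the full panel sum; the subtracted values add up to \<open>inner\<close> at
    \<open>c\<close>.\<close>
  also have "\<dots> = of_nat ?q * sum f ?P - (sum f ?P - f c)"
    using inner[OF cP] card_sphere_gen[OF i] by (simp add: sum_subtractf)
  finally have sum: "(\<Sum>d\<in>sphere (gen i) c. \<Sum>e\<in>sphere (gen i) d. f e) =
      of_nat ?q * sum f ?P - (sum f ?P - f c)" .
  have "(of_nat ?q :: complex) \<noteq> 0" using parameter_pos[OF i] by simp
  then show "op (gen i) (op (gen i) f) c =
    inverse (of_nat ?q) * f c + (1 - inverse (of_nat ?q)) * op (gen i) f c"
    unfolding averaging_op_def param_gen[OF i] sum_distrib_left[symmetric] sum inner[OF cP]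
    by (simp add: field_simps)
qed

text \<open>With v = w s the product v s = w is ascending, so B_w = B_v B_s. Thus B_w B_s = B_v B_s
  B_s, and the quadratic relation expands the last two factors.\<close>

lemma op_descent:
  assumes w: "w \<in> carrier G" and i: "i \<in> I" and l: "int (len (w \<otimes>\<^bsub>G\<^esub> gen i)) = int (len w) - 1"
  shows "op w \<circ> op (gen i) =
    scale_op (inverse (of_nat (q (gen i)))) (op (w \<otimes>\<^bsub>G\<^esub> gen i)) +
    scale_op (1 - inverse (of_nat (q (gen i)))) (op w)"
proof -
  let ?v = "w \<otimes>\<^bsub>G\<^esub> gen i" and ?a = "inverse (of_nat (q (gen i))) :: complex"
  have v: "?v \<in> carrier G" using w gen_closed[OF i] by simp
  have "len (?v \<otimes>\<^bsub>G\<^esub> gen i) = len ?v + 1" using l mult_gen_gen[OF w i] by simp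
  from op_ascent[OF v i this] have ow: "op w f = op ?v (op (gen i) f)" for f
    by (simp add: mult_gen_gen[OF w i] fun_eq_iff)
  have "op w (op (gen i) f) = (\<lambda>c. ?a * op ?v f c + (1 - ?a) * op w f c)" for f
  proof -
    \<comment> \<open>The summand 0 gives the inner term the shape \<open>k * f c + g c\<close>, so
      that \<open>op_linear\<close> applies twice.\<close>
    have "op w (op (gen i) f) = op ?v (\<lambda>c. ?a * f c + ((1 - ?a) * op (gen i) f c + 0))"
      unfolding ow[of "op (gen i) f"] by (simp add: op_gen_quadratic[OF i])
    also have "\<dots> = (\<lambda>c. ?a * op ?v f c + ((1 - ?a) * op w f c + op ?v (\<lambda>_. 0) c))"
      unfolding op_linear ow ..
    finally show ?thesis by (simp add: averaging_op_def)
  qed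
  then show ?thesis by (auto simp: fun_eq_iff scale_op_def)
qed


section \<open>The algebra of averaging operators\<close>

sublocale ops: Modules.module scale_op by (rule module_scale_op)

abbreviation opspan where "opspan \<equiv> ops.span (op ` carrier G)"

lemma op_in_span: "w \<in> carrier G \<Longrightarrow> op w \<in> opspan"
  by (intro ops.span_base imageI)

lemma span_induct_op [consumes 1, case_names zero step]:
  assumes "F \<in> opspan" and "P 0"
    and "\<And>k w F. w \<in> carrier G \<Longrightarrow> F \<in> opspan \<Longrightarrow> P F \<Longrightarrow> P (scale_op k (op w) + F)"
  shows "P F"
proof -
  have "F \<in> opspan \<and> P F"
    using assms(1)
  proof (induction rule: ops.span_induct_alt)
    case base
    then show ?case using assms(2) ops.span_zero by blast
  next
    case (step k x y)
    then obtain w where w: "w \<in> carrier G" "x = op w" by blast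
    then have "scale_op k x + y \<in> opspan"
      using step(2) by (intro ops.span_add ops.span_scale) (simp_all add: op_in_span)
    moreover have "P (scale_op k x + y)" using assms(3) step w by blast
    ultimately show ?case ..
  qed
  then show ?thesis ..
qed

section \<open>Linearity of the operators and closure under composition\<close>

lemma span_linear:
  assumes "F \<in> opspan"
  shows "F (\<lambda>c. k * f c + g c) = (\<lambda>c. k * F f c + F g c)"
  using assms
proof (induction rule: span_induct_op)
  case zero
  then show ?case by (simp add: fun_eq_iff)
next
  case (step k' w F)
  show ?case
    by (rule ext, simp add: step.IH op_linear scale_op_def, simp add: algebra_simps)
qed

text \<open>The type \<open>'c operator\<close> also contains nonlinear maps, for which composition
  fails to distribute on this side; membership in the span supplies the linearity of
  \<open>F\<close>.\<close>

lemma comp_linear: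
  assumes "F \<in> opspan"
  shows "F \<circ> (scale_op k H + H') = scale_op k (F \<circ> H) + (F \<circ> H')"
  using span_linear[OF assms] by (simp add: fun_eq_iff scale_op_def plus_fun_def)

text \<open>For k = -1 and both right factors zero, the two terms given by
  \<open>comp_linear\<close> cancel.\<close>

lemma span_comp_zero: "F \<in> opspan \<Longrightarrow> F \<circ> (0 :: 'c operator) = 0"
  using comp_linear[of F "-1" 0 0] by simp

lemma comp_gen_closed:
  assumes "F \<in> opspan" and i: "i \<in> I"
  shows "F \<circ> op (gen i) \<in> opspan"
  using assms(1)
proof (induction rule: span_induct_op)
  case zero
  have "(0 :: 'c operator) \<circ> op (gen i) = 0" by (simp add: fun_eq_iff)
  then show ?case by (simp only: ops.span_zero)
next
  case (step k w F)
  \<comment> \<open>Right multiplication by a generator changes the length by exactly one, so one of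
    the two relations applies.\<close>
  have "op w \<circ> op (gen i) \<in> opspan"
    using coxeter_length_mult_gen[OF matrix step.hyps(1), of "gen i"] i
      op_ascent[OF step.hyps(1) i] op_descent[OF step.hyps(1) i] step.hyps(1) gen_closed[OF i]
    by (auto intro!: ops.span_add ops.span_scale op_in_span)
  moreover have "(scale_op k (op w) + F) \<circ> op (gen i) =
      scale_op k (op w \<circ> op (gen i)) + (F \<circ> op (gen i))"
    by (auto simp: fun_eq_iff scale_op_def)
  ultimately show ?case using step.IH by (simp only: ops.span_add ops.span_scale)
qed

text \<open>Along a reduced word every step ascends, so \<open>op w\<close> is a composition of the
  operators of generators and these can be absorbed one at a time.\<close>

lemma comp_op_closed:
  assumes F: "F \<in> opspan" and w: "w \<in> carrier G"
  shows "F \<circ> op w \<in> opspan"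
proof -
  have "F \<circ> op (word_elt I m f) \<in> opspan" if "reduced I m f" for f
    using that
  proof (induction f rule: rev_induct)
    case Nil
    then show ?case using F by (simp add: word_elt_Nil op_one)
  next
    case (snoc i f)
    have fi: "f \<in> lists I" "i \<in> I" using snoc.prems by (auto simp: reduced_def)
    note red = reduced_snocD[OF matrix snoc.prems]
    have "op (word_elt I m (f @ [i])) = op (word_elt I m f) \<circ> op (gen i)"
      using op_ascent[OF word_elt_closed[OF fi(1)] fi(2) red(2)] by (simp add: word_elt_snoc[OF fi])
    then show ?case using comp_gen_closed[OF snoc.IH[OF red(1)] fi(2)] by (simp only: o_assoc)
  qed
  then show ?thesis using reduced_word_exists[OF matrix w] by metis
qed

lemma comp_closed:
  assumes F: "F \<in> opspan" and H: "H \<in> opspan"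
  shows "F \<circ> H \<in> opspan"
  using H
proof (induction rule: span_induct_op)
  case zero
  show ?case unfolding span_comp_zero[OF F] by (rule ops.span_zero)
next
  case (step k w H)
  then show ?case
    unfolding comp_linear[OF F] using comp_op_closed[OF F] by (intro ops.span_add ops.span_scale)
qed

end

lemma cring_complex_field: "cring complex_field"
  by (rule cringI; (rule abelian_groupI comm_monoidI)?)
    (auto simp: complex_field_def algebra_simps intro: exI[of _ "- x" for x])

context regular_building
begin

abbreviation A where "A \<equiv> averaging_algebra I m \<delta> q"

lemma A_simps:
  "carrier A = opspan" "monoid.mult A = (\<circ>)" "\<one>\<^bsub>A\<^esub> = id" "\<zero>\<^bsub>A\<^esub> = 0"
  "add A = (+)" "smult A = scale_op"
  by (simp_all add: averaging_algebra_def)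

lemma complex_algebra_averaging: "complex_algebra A"
proof -
  have ab: "abelian_group A"
  proof (rule abelian_groupI)
    fix F assume "F \<in> carrier A"
    then show "\<exists>H\<in>carrier A. H \<oplus>\<^bsub>A\<^esub> F = \<zero>\<^bsub>A\<^esub>"
      by (auto simp: A_simps intro!: bexI[of _ "- F"] ops.span_neg)
  qed (auto simp: A_simps ops.span_add ops.span_zero add.assoc add.commute)
  have mon: "Group.monoid A"
    using op_in_span[OF G.one_closed]
    by (intro monoidI) (auto simp: A_simps comp_closed o_assoc op_one)
  have ring: "ring A"
  proof (rule ringI[OF ab mon])
    fix F H K assume *: "F \<in> carrier A" "H \<in> carrier A" "K \<in> carrier A"
    show "(F \<oplus>\<^bsub>A\<^esub> H) \<otimes>\<^bsub>A\<^esub> K = F \<otimes>\<^bsub>A\<^esub> K \<oplus>\<^bsub>A\<^esub> H \<otimes>\<^bsub>A\<^esub> K"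
      by (simp add: A_simps fun_eq_iff)
    \<comment> \<open>Unlike the other distributive law, which is pointwise, this one needs the
      linearity of \<open>K\<close>.\<close>
    show "K \<otimes>\<^bsub>A\<^esub> (F \<oplus>\<^bsub>A\<^esub> H) = K \<otimes>\<^bsub>A\<^esub> F \<oplus>\<^bsub>A\<^esub> K \<otimes>\<^bsub>A\<^esub> H"
      using comp_linear[of K 1 F H] * by (simp add: A_simps)
  qed
  have "Module.module complex_field A"
    by (rule moduleI[OF cring_complex_field ab])
      (auto simp: A_simps complex_field_def ops.span_scale ops.scale_left_distrib
        ops.scale_right_distrib)
  moreover have "(k \<odot>\<^bsub>A\<^esub> F) \<otimes>\<^bsub>A\<^esub> H = k \<odot>\<^bsub>A\<^esub> (F \<otimes>\<^bsub>A\<^esub> H)" for k F H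
    by (simp add: A_simps fun_eq_iff scale_op_def)
  moreover have "F \<otimes>\<^bsub>A\<^esub> (k \<odot>\<^bsub>A\<^esub> H) = k \<odot>\<^bsub>A\<^esub> (F \<otimes>\<^bsub>A\<^esub> H)" if "F \<in> carrier A" for k F H
    using comp_linear[of F k H 0] span_comp_zero[of F] that by (simp add: A_simps)
  ultimately show ?thesis using ring by (simp add: complex_algebra_def)
qed


section \<open>Transport to the Hecke algebra\<close>

text \<open>The carrier of \<open>hecke_structure\<close> is the same for every product, so the
  linear bijection can be set up before a product is fixed.\<close>

definition hecke_carrier :: "('i sword set \<Rightarrow> complex) set" where
  "hecke_carrier = {x. finite {w. x w \<noteq> 0} \<and> {w. x w \<noteq> 0} \<subseteq> carrier G}"

lemma carrier_hecke_structure: "carrier (hecke_structure I m M) = hecke_carrier"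
  by (simp add: hecke_structure_def hecke_carrier_def)

text \<open>The linear extension of T_w \<mapsto> B_w. The sum runs over the support because W may
  be infinite.\<close>

definition to_op :: "('i sword set \<Rightarrow> complex) \<Rightarrow> 'c operator" where
  "to_op x = (\<lambda>f c. \<Sum>w | x w \<noteq> 0. x w * op w f c)"

text \<open>This allows functions with different supports to be summed over one index set.\<close>

lemma to_op_superset:
  assumes "finite F" "{w. x w \<noteq> 0} \<subseteq> F"
  shows "to_op x f c = (\<Sum>w\<in>F. x w * op w f c)"
  unfolding to_op_def using assms by (intro sum.mono_neutral_left) auto

lemma hecke_carrier_linear:
  assumes "x \<in> hecke_carrier" "y \<in> hecke_carrier"
  shows "(\<lambda>v. k * x v + y v) \<in> hecke_carrier"
proof -
  have "{v. k * x v + y v \<noteq> 0} \<subseteq> {v. x v \<noteq> 0} \<union> {v. y v \<noteq> 0}" by auto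
  then show ?thesis using assms unfolding hecke_carrier_def
    by (auto intro: finite_subset)
qed

lemma hecke_carrier_zero: "(\<lambda>v. 0) \<in> hecke_carrier"
  by (simp add: hecke_carrier_def)

lemma hecke_T_in_carrier: "w \<in> carrier G \<Longrightarrow> hecke_T w \<in> hecke_carrier"
  using hecke_T_closed carrier_hecke_structure by metis

lemma to_op_linear:
  assumes "x \<in> hecke_carrier" "y \<in> hecke_carrier"
  shows "to_op (\<lambda>v. k * x v + y v) = scale_op k (to_op x) + to_op y"
proof (intro ext)
  fix f c
  let ?F = "{v. x v \<noteq> 0} \<union> {v. y v \<noteq> 0}"
  have fin: "finite ?F" using assms by (auto simp: hecke_carrier_def)
  have "to_op (\<lambda>v. k * x v + y v) f c = (\<Sum>w\<in>?F. (k * x w + y w) * op w f c)"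
    using fin by (intro to_op_superset) auto
  also have "\<dots> = k * (\<Sum>w\<in>?F. x w * op w f c) + (\<Sum>w\<in>?F. y w * op w f c)"
    by (simp add: sum_distrib_left algebra_simps sum.distrib)
  also have "\<dots> = k * to_op x f c + to_op y f c"
    using fin by (simp add: to_op_superset[where F = ?F])
  finally show "to_op (\<lambda>v. k * x v + y v) f c = (scale_op k (to_op x) + to_op y) f c"
    by (simp add: scale_op_def)
qed

lemma to_op_zero: "to_op (\<lambda>v. 0) = 0"
  by (simp add: to_op_def fun_eq_iff)

lemma to_op_T: "to_op (hecke_T w) = op w"
  by (intro ext, subst to_op_superset[of "{w}"]) (auto simp: hecke_T_def)

lemma to_op_in_span:
  assumes "x \<in> hecke_carrier"
  shows "to_op x \<in> opspan"
  \<comment> \<open>The product is irrelevant to the carrier; \<open>undefined\<close> only fills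
    its place for the induction rule.\<close>
  using assms[folded carrier_hecke_structure[of undefined]]
proof (rule hecke_carrier_induct)
  show "to_op (\<lambda>v. 0) \<in> opspan" by (simp add: to_op_zero ops.span_zero)
  fix k w y assume "w \<in> carrier G" "y \<in> carrier (hecke_structure I m undefined)" "to_op y \<in> opspan"
  then show "to_op (\<lambda>v. k * hecke_T w v + y v) \<in> opspan"
    by (simp add: carrier_hecke_structure to_op_linear hecke_T_in_carrier to_op_T
        ops.span_add ops.span_scale op_in_span)
qed

lemma to_op_surj:
  assumes "F \<in> opspan"
  shows "F \<in> to_op ` hecke_carrier"
  using assms
proof (induction rule: span_induct_op)
  case zero
  then show ?case using to_op_zero hecke_carrier_zero by (metis imageI)
next
  case (step k w F)
  then obtain y where "y \<in> hecke_carrier" "F = to_op y" by auto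
  then show ?case
    using to_op_linear[of "hecke_T w" y k] hecke_carrier_linear[of "hecke_T w" y k]
      hecke_T_in_carrier[OF step.hyps(1)]
    by (auto simp: to_op_T intro!: image_eqI[of _ _ "\<lambda>v. k * hecke_T w v + y v"])
qed

text \<open>Testing on the indicator of \<open>d\<close> isolates one coefficient: among the spheres
  around \<open>c\<close>, only that of \<open>w\<close> contains \<open>d\<close>. This is the
  linear independence of the averaging operators.\<close>

lemma to_op_coefficient:
  assumes x: "x \<in> hecke_carrier" and w: "w \<in> carrier G" and d: "d \<in> sphere w c"
  shows "to_op x (\<lambda>e. if e = d then 1 else 0) c = x w / of_nat (param I m q w)"
proof -
  \<comment> \<open>\<open>w\<close> is inserted because \<open>x w\<close> may be zero.\<close>
  let ?F = "insert w {v. x v \<noteq> 0}"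
  have fin: "finite ?F" and F: "?F \<subseteq> carrier G" using x w by (auto simp: hecke_carrier_def)
  have op: "op v (\<lambda>e. if e = d then 1 else 0) c =
      (if v = w then 1 / of_nat (param I m q w) else 0)" if "v \<in> ?F" for v
  proof -
    have "finite (sphere v c)" using that F finite_sphere by blast
    then show ?thesis using d by (auto simp: averaging_op_def mem_chamber_sphere)
  qed
  have "to_op x (\<lambda>e. if e = d then 1 else 0) c =
      (\<Sum>v\<in>?F. x v * (if v = w then 1 / of_nat (param I m q w) else 0))"
    unfolding to_op_superset[OF fin subset_insertI] by (rule sum.cong) (simp_all only: op)
  also have "\<dots> = (\<Sum>v\<in>?F. if v = w then x w / of_nat (param I m q w) else 0)"
    by (intro sum.cong) auto
  also have "\<dots> = x w / of_nat (param I m q w)" using fin by (subst sum.delta) auto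
  finally show ?thesis .
qed

lemma to_op_inj: "inj_on to_op hecke_carrier"
proof (intro inj_onI ext)
  fix x y w assume x: "x \<in> hecke_carrier" and y: "y \<in> hecke_carrier" and eq: "to_op x = to_op y"
  show "x w = y w"
  proof (cases "w \<in> carrier G")
    case True
    \<comment> \<open>Any centre would do; \<open>undefined\<close> names some chamber.\<close>
    then obtain d where "d \<in> sphere w undefined" using sphere_nonempty by blast
    then show ?thesis
      using to_op_coefficient[OF x True] to_op_coefficient[OF y True] param_pos[OF True] eq by simp
  next
    case False
    then have "x w = 0" "y w = 0" using x y unfolding hecke_carrier_def by blast+
    then show ?thesis by simp
  qed
qed

lemma bij_to_op: "bij_betw to_op hecke_carrier opspan"
  using to_op_inj to_op_in_span to_op_surj by (auto simp: bij_betw_def)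

section \<open>The inverse bijection and the transported product\<close>

definition of_op :: "'c operator \<Rightarrow> 'i sword set \<Rightarrow> complex" where
  "of_op = inv_into hecke_carrier to_op"

lemma bij_of_op: "bij_betw of_op opspan hecke_carrier"
  unfolding of_op_def by (rule bij_betw_inv_into[OF bij_to_op])

lemma of_op_closed: "F \<in> opspan \<Longrightarrow> of_op F \<in> hecke_carrier"
  using bij_of_op by (auto simp: bij_betw_def)

lemma to_op_of_op: "F \<in> opspan \<Longrightarrow> to_op (of_op F) = F"
  unfolding of_op_def by (simp add: f_inv_into_f to_op_surj)

lemma of_op_to_op: "x \<in> hecke_carrier \<Longrightarrow> of_op (to_op x) = x"
  unfolding of_op_def by (rule inv_into_f_f[OF to_op_inj])

lemma of_op_linear:
  assumes "F \<in> opspan" "H \<in> opspan"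
  shows "of_op (scale_op k F + H) = (\<lambda>v. k * of_op F v + of_op H v)"
proof -
  have "to_op (\<lambda>v. k * of_op F v + of_op H v) = scale_op k F + H"
    using assms by (simp add: to_op_linear of_op_closed to_op_of_op)
  then show ?thesis using assms by (metis of_op_to_op hecke_carrier_linear of_op_closed)
qed

lemma of_op_op: "w \<in> carrier G \<Longrightarrow> of_op (op w) = hecke_T w"
  using of_op_to_op[OF hecke_T_in_carrier] by (simp add: to_op_T)

lemma of_op_zero: "of_op 0 = (\<lambda>v. 0)"
  using of_op_to_op[OF hecke_carrier_zero] by (simp add: to_op_zero)

lemma of_op_scale: "F \<in> opspan \<Longrightarrow> of_op (scale_op k F) = (\<lambda>v. k * of_op F v)"
  using of_op_linear[of F 0 k] by (simp add: of_op_zero ops.span_zero)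

lemma of_op_add: "F \<in> opspan \<Longrightarrow> H \<in> opspan \<Longrightarrow> of_op (F + H) = (\<lambda>v. of_op F v + of_op H v)"
  using of_op_linear[of F H 1] by simp

definition op_product ::
  "('i sword set \<Rightarrow> complex) \<Rightarrow> ('i sword set \<Rightarrow> complex) \<Rightarrow> 'i sword set \<Rightarrow> complex" where
  "op_product x y = of_op (to_op x \<circ> to_op y)"

abbreviation H where "H \<equiv> hecke_structure I m op_product"

text \<open>\<open>M\<close> is general because the product of \<open>hecke_algebra\<close> comes
  from a choice and will be known only on the carrier.\<close>

lemma ring_iso_of_op:
  assumes "\<And>x y. x \<in> hecke_carrier \<Longrightarrow> y \<in> hecke_carrier \<Longrightarrow> M x y = op_product x y"
  shows "of_op \<in> ring_iso A (hecke_structure I m M)"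
proof -
  have "of_op id = hecke_T \<one>\<^bsub>G\<^esub>" using of_op_op[OF G.one_closed] by (simp add: op_one)
  then show ?thesis
    unfolding ring_iso_def ring_hom_def using bij_of_op assms
    by (auto simp: A_simps carrier_hecke_structure hecke_structure_simps of_op_closed of_op_add
        op_product_def to_op_of_op)
qed

lemma ring_H: "ring H"
proof -
  have iso: "of_op \<in> ring_iso A H" by (rule ring_iso_of_op) simp
  have "ring A" using complex_algebra_averaging by (simp add: complex_algebra_def)
  then have "ring (H\<lparr>zero := of_op \<zero>\<^bsub>A\<^esub>\<rparr>)"
    using iso by (rule ring.ring_iso_imp_img_ring)
  \<comment> \<open>The image ring is obtained with its zero replaced by the image of zero, which is
    the zero function already.\<close>
  moreover have "H\<lparr>zero := of_op \<zero>\<^bsub>A\<^esub>\<rparr> = H"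
    unfolding A_simps of_op_zero by (simp add: hecke_structure_def zero_fun_def)
  ultimately show ?thesis by simp
qed

lemma complex_algebra_H: "complex_algebra H"
proof -
  interpret R: ring H by (rule ring_H)
  \<comment> \<open>Scalar multiplication is transported as well, so its compatibility with the
    product reduces to that of operators.\<close>
  have smult: "k \<odot>\<^bsub>H\<^esub> x = of_op (scale_op k (to_op x))" if "x \<in> carrier H" for k x
    using that of_op_scale[OF to_op_in_span, of x k]
    by (simp add: carrier_hecke_structure hecke_structure_simps of_op_to_op)
  have "Module.module complex_field H"
    by (rule moduleI[OF cring_complex_field R.abelian_group_axioms])
      (use hecke_smult_closed[of _ I m op_product] in
        \<open>auto simp: hecke_structure_simps complex_field_def algebra_simps\<close>)
  moreover have "(k \<odot>\<^bsub>H\<^esub> x) \<otimes>\<^bsub>H\<^esub> y = k \<odot>\<^bsub>H\<^esub> (x \<otimes>\<^bsub>H\<^esub> y)"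
    and "x \<otimes>\<^bsub>H\<^esub> (k \<odot>\<^bsub>H\<^esub> y) = k \<odot>\<^bsub>H\<^esub> (x \<otimes>\<^bsub>H\<^esub> y)"
    if xy: "x \<in> carrier H" "y \<in> carrier H" for k x y
  proof -
    have sp: "to_op x \<in> opspan" "to_op y \<in> opspan"
      using xy to_op_in_span by (simp_all add: carrier_hecke_structure)
    note cl = comp_closed[OF sp]
    have "scale_op k (to_op x) \<circ> to_op y = scale_op k (to_op x \<circ> to_op y)"
      by (simp add: fun_eq_iff scale_op_def)
    moreover have "to_op x \<circ> scale_op k (to_op y) = scale_op k (to_op x \<circ> to_op y)"
      using comp_linear[OF sp(1), of k "to_op y" 0] span_comp_zero[OF sp(1)] by simp
    moreover have "k \<odot>\<^bsub>H\<^esub> (x \<otimes>\<^bsub>H\<^esub> y) = of_op (scale_op k (to_op x \<circ> to_op y))"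
      using smult[OF R.m_closed[OF xy]] cl
      by (simp add: hecke_structure_simps op_product_def to_op_of_op)
    ultimately show "(k \<odot>\<^bsub>H\<^esub> x) \<otimes>\<^bsub>H\<^esub> y = k \<odot>\<^bsub>H\<^esub> (x \<otimes>\<^bsub>H\<^esub> y)"
      "x \<otimes>\<^bsub>H\<^esub> (k \<odot>\<^bsub>H\<^esub> y) = k \<odot>\<^bsub>H\<^esub> (x \<otimes>\<^bsub>H\<^esub> y)"
      unfolding smult[OF xy(1)] smult[OF xy(2)]
      by (simp_all add: hecke_structure_simps(1) op_product_def to_op_of_op ops.span_scale sp)
  qed
  ultimately show ?thesis using ring_H by (simp add: complex_algebra_def)
qed

section \<open>Hecke relations for the transported product and the isomorphism\<close>

lemma op_product_T:
  "w \<in> carrier G \<Longrightarrow> v \<in> carrier G \<Longrightarrow> op_product (hecke_T w) (hecke_T v) = of_op (op w \<circ> op v)"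
  by (simp add: op_product_def to_op_T)

text \<open>Besides the relations, this provides the witness that makes the choice in
  \<open>hecke_algebra\<close> meaningful.\<close>

lemma is_hecke_product_op_product:
  "is_hecke_product I m (\<lambda>s. inverse (of_nat (q s))) (\<lambda>s. 1 - inverse (of_nat (q s))) op_product"
proof -
  have "op_product (hecke_T w) (hecke_T (gen i)) = hecke_T (w \<otimes>\<^bsub>G\<^esub> gen i)"
    if "w \<in> carrier G" "i \<in> I" "len (w \<otimes>\<^bsub>G\<^esub> gen i) = len w + 1" for w i
    using that op_ascent[OF that] by (simp add: op_product_T gen_closed of_op_op)
  moreover have "op_product (hecke_T w) (hecke_T (gen i)) =
      (\<lambda>v. inverse (of_nat (q (gen i))) * hecke_T (w \<otimes>\<^bsub>G\<^esub> gen i) v +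
        (1 - inverse (of_nat (q (gen i)))) * hecke_T w v)"
    if "w \<in> carrier G" "i \<in> I" "int (len (w \<otimes>\<^bsub>G\<^esub> gen i)) = int (len w) - 1" for w i
    using that op_descent[OF that]
    by (simp add: op_product_T gen_closed of_op_linear of_op_scale of_op_op op_in_span
        ops.span_scale)
  ultimately show ?thesis
    unfolding is_hecke_product_def Let_def hecke_structure_simps
    using hecke_parameters complex_algebra_H by fastforce
qed

lemma averaging_iso_hecke:
  "algebras_isomorphic A
    (hecke_algebra I m (\<lambda>s. inverse (of_nat (q s))) (\<lambda>s. 1 - inverse (of_nat (q s))))"
proof -
  let ?a = "\<lambda>s. inverse (of_nat (q s)) :: complex" and ?b = "\<lambda>s. 1 - inverse (of_nat (q s)) :: complex"
  let ?M = "SOME M. is_hecke_product I m ?a ?b M"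
  have M: "is_hecke_product I m ?a ?b ?M" 
    by (rule someI[where P = "is_hecke_product I m ?a ?b", OF is_hecke_product_op_product])
  \<comment> \<open>The chosen product may differ from \<open>op_product\<close> off the carrier,
    but uniqueness forces agreement on it, which is all the isomorphism uses.\<close>
  have "?M x y = op_product x y" if "x \<in> hecke_carrier" "y \<in> hecke_carrier" for x y
    using hecke_product_unique[OF matrix M is_hecke_product_op_product] that
    by (simp add: carrier_hecke_structure)
  then have "of_op \<in> ring_iso A (hecke_structure I m ?M)" by (rule ring_iso_of_op)
  moreover have "complex_algebra (hecke_structure I m ?M)"
    using M unfolding is_hecke_product_def by blast
  ultimately show ?thesis
    unfolding algebras_isomorphic_def hecke_algebra_def
    using complex_algebra_averaging
    by (auto simp: A_simps hecke_structure_simps of_op_scale intro!: bexI[of _ of_op])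
qed

end

theorem theorem3p10:
  fixes I :: "'i set"
    and m :: "'i \<Rightarrow> 'i \<Rightarrow> enat"
    and adj :: "'i \<Rightarrow> ('c \<times> 'c) set"
    and \<delta> :: "'c \<Rightarrow> 'c \<Rightarrow> 'i sword set"
    and q :: "'i sword set \<Rightarrow> nat"
  assumes "building I m adj \<delta>"
    and "locally_finite I adj"
    and "regular_with_parameters I m \<delta> q"
  shows "algebras_isomorphic (averaging_algebra I m \<delta> q)
           (hecke_algebra I m (\<lambda>s. inverse (of_nat (q s))) (\<lambda>s. 1 - inverse (of_nat (q s))))"
proof -
  interpret regular_building I m adj \<delta> q using assms by unfold_locales
  show ?thesis by (rule averaging_iso_hecke)
qed

end
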